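(* Let $\mathcal{A}$ be a dg category. There is a natural isomorphism of dg functors $$\mathrm{Tot}_{\mathcal{A}^{op}}\circ(-)^{op}\;\cong\;\Sigma^2(-)^\vee\circ\mathrm{Tot}_{\mathcal{A}}^{op}\colon\ \mathrm{Cpx}^3_{dg}(\mathcal{A})^{op}\longrightarrow\mathrm{pretr}(\mathcal{A}^{op}).$$ In particular, for every 3-term complex $\xi$ in $\mathcal{A}$, there is a natural isomorphism $M_{\xi^{op}}\cong\Sigma^2(M_\xi)^\vee$.
   Context: Conventions. All dg categories are small, cohomologically graded, and additive ($H^0(\mathcal{A})$ is additive). $\mathcal{C}_{dg}(\mathcal{A})$ is the dg category of right dg $\mathcal{A}$-modules; $X\in\mathcal{A}$ is identified with the representable module $\mathcal{A}(-,X)$; $\Sigma$ is the shift. $\mathrm{pretr}(\mathcal{A})\subseteq\mathcal{C}_{dg}(\mathcal{A})$ is the full dg subcategory of modules obtained (up to isomorphism) from representables by finitely many shifts and cones of closed degree-0 morphisms. In an opposite dg category, $a^{op}\circ b^{op}=(-1)^{|a||b|}(b\circ a)^{op}$ and $d(a^{op})=(da)^{op}$. $\mathrm{Cpx}^3_{dg}(\mathcal{A})$ (the dg category of strictly unital $A_\infty$-functors to $\mathcal{A}$ from the path category of $0\xrightarrow{a}1\xrightarrow{b}2$ with $ba=0$) is described explicitly as follows. Objects are 3-term complexes $\xi=(A\xrightarrow{f}B\xrightarrow{g}C,h)$: $f,g$ closed of degree 0 and $h:A\to C$ of degree $-1$ with $d(h)=-gf$. A degree-$n$ morphism $\Xi:\xi\to\xi'$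 is a sextuple $(r_0,r_1,r_2,s_1,s_2,t)$ with $r_0:A\to A'$, $r_1:B\to B'$, $r_2:C\to C'$ of degree $n$, $s_1:A\to B'$, $s_2:B\to C'$ of degree $n-1$, $t:A\to C'$ of degree $n-2$; its differential is $(d r_0,d r_1,d r_2,\ d s_1+(-1)^{n+1}f'r_0+(-1)^nr_1f,\ d s_2+(-1)^{n+1}g'r_1+(-1)^nr_2g,\ d t+(-1)^ng's_1+h'r_0+(-1)^ns_2f+(-1)^{n+1}r_2h)$; the composite of $\Xi$ (degree $n$) followed by $\Theta=(r_i',s_j',t')$ is $(r_0'r_0,r_1'r_1,r_2'r_2,\ r_1's_1+(-1)^ns_1'r_0,\ r_2's_2+(-1)^ns_2'r_1,\ r_2't+t'r_0+(-1)^{n+1}s_2's_1)$. The dg functor $(-)^{op}:\mathrm{Cpx}^3_{dg}(\mathcal{A})^{op}\to\mathrm{Cpx}^3_{dg}(\mathcal{A}^{op})$ sends $\xi$ to $\xi^{op}=(C\xrightarrow{g^{op}}B\xrightarrow{f^{op}}A,h^{op})$ and $\Xi$ to $\Xi^{op}=(r_2^{op},r_1^{op},r_0^{op},-s_2^{op},-s_1^{op},-t^{op}):(\xi')^{op}\to\xi^{op}$. The dg totalization functor $\mathrm{Tot}_{\mathcal{A}}:\mathrm{Cpx}^3_{dg}(\mathcal{A})\to\mathrm{pretr}(\mathcal{A})$ is obtained by applying Yoneda, viewing $\xi$ as the homotopy-commutative square with edges $f:A\to B$, $A\to0$, $g:B\to C$, $0\to C$ and homotopy $-h$, and taking the cone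 functor twice. Explicitly, $\mathrm{Tot}_{\mathcal{A}}(\xi)=M_\xi=\mathrm{Cone}\bigl(\begin{bmatrix}-h&g\end{bmatrix}:\mathrm{Cone}(f)\to C\bigr)$, i.e. $\Sigma^2A\oplus\Sigma B\oplus C$ with differential $\begin{bmatrix}d_{\Sigma^2A}&0&0\\-f&d_{\Sigma B}&0\\-h&g&d_C\end{bmatrix}$, and a degree-$n$ morphism $\Xi$ goes to the matrix $\begin{bmatrix}r_0&0&0\\(-1)^{n+1}s_1&(-1)^nr_1&0\\-t&-s_2&r_2\end{bmatrix}$, entries being read as maps of the underlying graded modules. The dg duality $(-)^\vee:\mathrm{pretr}(\mathcal{A})^{op}\to\mathrm{pretr}(\mathcal{A}^{op})$ is $M^\vee=\mathrm{pretr}(\mathcal{A})(M,-)|_{\mathcal{A}}$, and $\Sigma^2(-)^\vee$ is its composite with $\Sigma^2$. *)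

theory Defs
  imports Main "HOL-Library.Function_Algebras" "HOL-Library.Product_Plus"
begin

definition sg :: "int \<Rightarrow> 'a::ab_group_add \<Rightarrow> 'a" where
  "sg n x = (if even n then x else - x)"  \<comment> \<open>multiplication by \<open>(-1)^n\<close>\<close>

definition kmodule :: "'v::ab_group_add set \<Rightarrow> ('k::comm_ring_1 \<Rightarrow> 'v \<Rightarrow> 'v) \<Rightarrow> bool" where
  "kmodule V s \<longleftrightarrow>
     0 \<in> V \<and> (\<forall>x\<in>V. \<forall>y\<in>V. x + y \<in> V) \<and> (\<forall>x\<in>V. - x \<in> V) \<and> (\<forall>c. \<forall>x\<in>V. s c x \<in> V) \<and>
     (\<forall>c. \<forall>x\<in>V. \<forall>y\<in>V. s c (x + y) = s c x + s c y) \<and>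
     (\<forall>c d. \<forall>x\<in>V. s (c + d) x = s c x + s d x) \<and>
     (\<forall>c d. \<forall>x\<in>V. s (c * d) x = s c (s d x)) \<and>
     (\<forall>x\<in>V. s 1 x = x)"


section \<open>Dg categories\<close>

text \<open>
  A dg category over the commutative ring \<open>'k\<close>: every \<open>hom X Y n\<close> (the degree \<open>n\<close> part of the
  Hom complex) is a subgroup of the abelian group \<open>'m\<close>, with its own \<open>'k\<close>-action \<open>scl X Y n\<close>.
  Every small dg category is isomorphic to one of this form, with \<open>'m\<close> the direct sum of all the
  \<open>Hom^n(X,Y)\<close>. The Hom groups need not be disjoint, so all operations are indexed by objects and
  degrees:

  \<^item> \<open>dif X Y n : Hom^n(X,Y) \<rightarrow> Hom^(n+1)(X,Y)\<close>,
  \<^item> \<open>cmp X Y Z m n : Hom^m(Y,Z) \<times> Hom^n(X,Y) \<rightarrow> Hom^(m+n)(X,Z)\<close>, \<open>(g, f) \<mapsto> g \<circ> f\<close>.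
\<close>

record ('k, 'o, 'm) dgcat =
  obj :: "'o set"
  hom :: "'o \<Rightarrow> 'o \<Rightarrow> int \<Rightarrow> 'm set"
  scl :: "'o \<Rightarrow> 'o \<Rightarrow> int \<Rightarrow> 'k \<Rightarrow> 'm \<Rightarrow> 'm"
  dif :: "'o \<Rightarrow> 'o \<Rightarrow> int \<Rightarrow> 'm \<Rightarrow> 'm"
  cmp :: "'o \<Rightarrow> 'o \<Rightarrow> 'o \<Rightarrow> int \<Rightarrow> int \<Rightarrow> 'm \<Rightarrow> 'm \<Rightarrow> 'm"
  idn :: "'o \<Rightarrow> 'm"

locale dg_category =
  fixes A :: "('k::comm_ring_1, 'o, 'm::ab_group_add) dgcat"
  assumes hom_kmodule:
      "\<lbrakk>X \<in> obj A; Y \<in> obj A\<rbrakk> \<Longrightarrow> kmodule (hom A X Y n) (scl A X Y n)"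
    and dif_hom:
      "\<lbrakk>X \<in> obj A; Y \<in> obj A; f \<in> hom A X Y n\<rbrakk> \<Longrightarrow> dif A X Y n f \<in> hom A X Y (n + 1)"
    and dif_add:
      "\<lbrakk>X \<in> obj A; Y \<in> obj A; f \<in> hom A X Y n; f' \<in> hom A X Y n\<rbrakk>
        \<Longrightarrow> dif A X Y n (f + f') = dif A X Y n f + dif A X Y n f'"
    and dif_scl:
      "\<lbrakk>X \<in> obj A; Y \<in> obj A; f \<in> hom A X Y n\<rbrakk>
        \<Longrightarrow> dif A X Y n (scl A X Y n c f) = scl A X Y (n + 1) c (dif A X Y n f)"
    and dif_dif:
      "\<lbrakk>X \<in> obj A; Y \<in> obj A; f \<in> hom A X Y n\<rbrakk> \<Longrightarrow> dif A X Y (n + 1) (dif A X Y n f) = 0"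
    and cmp_hom:
      "\<lbrakk>X \<in> obj A; Y \<in> obj A; Z \<in> obj A; g \<in> hom A Y Z m; f \<in> hom A X Y n\<rbrakk>
        \<Longrightarrow> cmp A X Y Z m n g f \<in> hom A X Z (m + n)"
    and cmp_add_left:
      "\<lbrakk>X \<in> obj A; Y \<in> obj A; Z \<in> obj A; g \<in> hom A Y Z m; g' \<in> hom A Y Z m; f \<in> hom A X Y n\<rbrakk>
        \<Longrightarrow> cmp A X Y Z m n (g + g') f = cmp A X Y Z m n g f + cmp A X Y Z m n g' f"
    and cmp_add_right:
      "\<lbrakk>X \<in> obj A; Y \<in> obj A; Z \<in> obj A; g \<in> hom A Y Z m; f \<in> hom A X Y n; f' \<in> hom A X Y n\<rbrakk>
        \<Longrightarrow> cmp A X Y Z m n g (f + f') = cmp A X Y Z m n g f + cmp A X Y Z m n g f'"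
    and cmp_scl_left:
      "\<lbrakk>X \<in> obj A; Y \<in> obj A; Z \<in> obj A; g \<in> hom A Y Z m; f \<in> hom A X Y n\<rbrakk>
        \<Longrightarrow> cmp A X Y Z m n (scl A Y Z m c g) f = scl A X Z (m + n) c (cmp A X Y Z m n g f)"
    and cmp_scl_right:
      "\<lbrakk>X \<in> obj A; Y \<in> obj A; Z \<in> obj A; g \<in> hom A Y Z m; f \<in> hom A X Y n\<rbrakk>
        \<Longrightarrow> cmp A X Y Z m n g (scl A X Y n c f) = scl A X Z (m + n) c (cmp A X Y Z m n g f)"
    and cmp_assoc:
      "\<lbrakk>W \<in> obj A; X \<in> obj A; Y \<in> obj A; Z \<in> obj A;
        h \<in> hom A Y Z l; g \<in> hom A X Y m; f \<in> hom A W X n\<rbrakk>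
        \<Longrightarrow> cmp A W X Z (l + m) n (cmp A X Y Z l m h g) f
          = cmp A W Y Z l (m + n) h (cmp A W X Y m n g f)"
    and dif_cmp:
      "\<lbrakk>X \<in> obj A; Y \<in> obj A; Z \<in> obj A; g \<in> hom A Y Z m; f \<in> hom A X Y n\<rbrakk>
        \<Longrightarrow> dif A X Z (m + n) (cmp A X Y Z m n g f)
          = cmp A X Y Z (m + 1) n (dif A Y Z m g) f + sg m (cmp A X Y Z m (n + 1) g (dif A X Y n f))"
    and idn_hom: "X \<in> obj A \<Longrightarrow> idn A X \<in> hom A X X 0"
    and cmp_idn_left:
      "\<lbrakk>X \<in> obj A; Y \<in> obj A; f \<in> hom A X Y n\<rbrakk> \<Longrightarrow> cmp A X Y Y 0 n (idn A Y) f = f"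
    and cmp_idn_right:
      "\<lbrakk>X \<in> obj A; Y \<in> obj A; f \<in> hom A X Y n\<rbrakk> \<Longrightarrow> cmp A X X Y n 0 f (idn A X) = f"

text \<open>The standing assumption that \<open>H^0(A)\<close> is additive: it has a zero object and binary biproducts.\<close>

definition closed0 :: "('k, 'o, 'm::ab_group_add) dgcat \<Rightarrow> 'o \<Rightarrow> 'o \<Rightarrow> 'm set" where
  "closed0 A X Y = {f \<in> hom A X Y 0. dif A X Y 0 f = 0}"

definition h0_eq :: "('k, 'o, 'm::ab_group_add) dgcat \<Rightarrow> 'o \<Rightarrow> 'o \<Rightarrow> 'm \<Rightarrow> 'm \<Rightarrow> bool" where
  "h0_eq A X Y f g \<longleftrightarrow> (\<exists>u\<in>hom A X Y (-1). f - g = dif A X Y (-1) u)"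

definition additive_dg :: "('k, 'o, 'm::ab_group_add) dgcat \<Rightarrow> bool" where
  "additive_dg A \<longleftrightarrow>
     (\<exists>Z\<in>obj A. \<forall>X\<in>obj A. (\<forall>f\<in>closed0 A X Z. h0_eq A X Z f 0) \<and> (\<forall>f\<in>closed0 A Z X. h0_eq A Z X f 0)) \<and>
     (\<forall>X\<in>obj A. \<forall>Y\<in>obj A. \<exists>P\<in>obj A.
        \<exists>i\<in>closed0 A X P. \<exists>j\<in>closed0 A Y P. \<exists>p\<in>closed0 A P X. \<exists>q\<in>closed0 A P Y.
          h0_eq A X X (cmp A X P X 0 0 p i) (idn A X) \<and>
          h0_eq A Y Y (cmp A Y P Y 0 0 q j) (idn A Y) \<and>
          h0_eq A X Y (cmp A X P Y 0 0 q i) 0 \<and>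
          h0_eq A Y X (cmp A Y P X 0 0 p j) 0 \<and>
          h0_eq A P P (cmp A P X P 0 0 i p + cmp A P Y P 0 0 j q) (idn A P))"

definition opp :: "('k, 'o, 'm::ab_group_add) dgcat \<Rightarrow> ('k, 'o, 'm) dgcat" where
  "opp A = \<lparr>obj = obj A, hom = (\<lambda>X Y. hom A Y X), scl = (\<lambda>X Y. scl A Y X), dif = (\<lambda>X Y. dif A Y X),
     cmp = (\<lambda>X Y Z m n a b. sg (m * n) (cmp A Z Y X n m b a)), idn = idn A\<rparr>"


section \<open>Dg functors and natural isomorphisms\<close>

record ('o, 'm, 'p, 'q) dgfun =
  fob :: "'o \<Rightarrow> 'p"
  fmor :: "'o \<Rightarrow> 'o \<Rightarrow> int \<Rightarrow> 'm \<Rightarrow> 'q"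

definition dg_functor ::
  "('k, 'o, 'm::ab_group_add) dgcat \<Rightarrow> ('k, 'p, 'q::ab_group_add) dgcat \<Rightarrow> ('o, 'm, 'p, 'q) dgfun \<Rightarrow> bool"
  where
  "dg_functor C D F \<longleftrightarrow>
     (\<forall>X\<in>obj C. fob F X \<in> obj D) \<and>
     (\<forall>X\<in>obj C. \<forall>Y\<in>obj C. \<forall>n. \<forall>f\<in>hom C X Y n.
        fmor F X Y n f \<in> hom D (fob F X) (fob F Y) n \<and>
        (\<forall>f'\<in>hom C X Y n. fmor F X Y n (f + f') = fmor F X Y n f + fmor F X Y n f') \<and>
        (\<forall>c. fmor F X Y n (scl C X Y n c f) = scl D (fob F X) (fob F Y) n c (fmor F X Y n f)) \<and>
        fmor F X Y (n + 1) (dif C X Y n f) = dif D (fob F X) (fob F Y) n (fmor F X Y n f)) \<and>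
     (\<forall>X\<in>obj C. \<forall>Y\<in>obj C. \<forall>Z\<in>obj C. \<forall>m n. \<forall>g\<in>hom C Y Z m. \<forall>f\<in>hom C X Y n.
        fmor F X Z (m + n) (cmp C X Y Z m n g f)
          = cmp D (fob F X) (fob F Y) (fob F Z) m n (fmor F Y Z m g) (fmor F X Y n f)) \<and>
     (\<forall>X\<in>obj C. fmor F X X 0 (idn C X) = idn D (fob F X))"

definition fcomp :: "('p, 'q, 'r, 's) dgfun \<Rightarrow> ('o, 'm, 'p, 'q) dgfun \<Rightarrow> ('o, 'm, 'r, 's) dgfun"
    (infixr "\<circ>\<^sub>F" 55) where
  "G \<circ>\<^sub>F F = \<lparr>fob = fob G \<circ> fob F,
     fmor = (\<lambda>X Y n. fmor G (fob F X) (fob F Y) n \<circ> fmor F X Y n)\<rparr>"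

definition opp_fun :: "('o, 'm, 'p, 'q) dgfun \<Rightarrow> ('o, 'm, 'p, 'q) dgfun" where
  "opp_fun F = \<lparr>fob = fob F, fmor = (\<lambda>X Y. fmor F Y X)\<rparr>"

definition dg_nat_iso ::
  "('k, 'o, 'm::ab_group_add) dgcat \<Rightarrow> ('k, 'p, 'q::ab_group_add) dgcat \<Rightarrow>
   ('o, 'm, 'p, 'q) dgfun \<Rightarrow> ('o, 'm, 'p, 'q) dgfun \<Rightarrow> ('o \<Rightarrow> 'q) \<Rightarrow> bool" where
  "dg_nat_iso C D F G \<eta> \<longleftrightarrow>
     dg_functor C D F \<and> dg_functor C D G \<and>
     (\<forall>X\<in>obj C. \<eta> X \<in> closed0 D (fob F X) (fob G X) \<and>
        (\<exists>\<theta>\<in>closed0 D (fob G X) (fob F X).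
           cmp D (fob F X) (fob G X) (fob F X) 0 0 \<theta> (\<eta> X) = idn D (fob F X) \<and>
           cmp D (fob G X) (fob F X) (fob G X) 0 0 (\<eta> X) \<theta> = idn D (fob G X))) \<and>
     (\<forall>X\<in>obj C. \<forall>Y\<in>obj C. \<forall>n. \<forall>f\<in>hom C X Y n.
        cmp D (fob F X) (fob G X) (fob G Y) n 0 (fmor G X Y n f) (\<eta> X)
          = cmp D (fob F X) (fob F Y) (fob G Y) 0 n (\<eta> Y) (fmor F X Y n f))"


section \<open>Right dg modules\<close>

text \<open>
  \<open>mact M X Y p q : M(Y)^p \<times> Hom^q(X,Y) \<rightarrow> M(X)^(p+q)\<close> is the right action \<open>(x, a) \<mapsto> x \<cdot> a\<close>. As for
  Hom complexes, the \<open>M(X)^p\<close> are subgroups of an abelian group \<open>'v\<close>.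
\<close>

record ('k, 'o, 'm, 'v) dgmod =
  mcar :: "'o \<Rightarrow> int \<Rightarrow> 'v set"
  mscl :: "'o \<Rightarrow> int \<Rightarrow> 'k \<Rightarrow> 'v \<Rightarrow> 'v"
  mdif :: "'o \<Rightarrow> int \<Rightarrow> 'v \<Rightarrow> 'v"
  mact :: "'o \<Rightarrow> 'o \<Rightarrow> int \<Rightarrow> int \<Rightarrow> 'v \<Rightarrow> 'm \<Rightarrow> 'v"

locale dg_module = dg_category A
  for A :: "('k::comm_ring_1, 'o, 'm::ab_group_add) dgcat" +
  fixes M :: "('k, 'o, 'm, 'v::ab_group_add) dgmod"
  assumes mcar_kmodule: "X \<in> obj A \<Longrightarrow> kmodule (mcar M X p) (mscl M X p)"
    and mdif_mcar: "\<lbrakk>X \<in> obj A; x \<in> mcar M X p\<rbrakk> \<Longrightarrow> mdif M X p x \<in> mcar M X (p + 1)"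
    and mdif_add: "\<lbrakk>X \<in> obj A; x \<in> mcar M X p; y \<in> mcar M X p\<rbrakk>
        \<Longrightarrow> mdif M X p (x + y) = mdif M X p x + mdif M X p y"
    and mdif_mscl: "\<lbrakk>X \<in> obj A; x \<in> mcar M X p\<rbrakk>
        \<Longrightarrow> mdif M X p (mscl M X p c x) = mscl M X (p + 1) c (mdif M X p x)"
    and mdif_mdif: "\<lbrakk>X \<in> obj A; x \<in> mcar M X p\<rbrakk> \<Longrightarrow> mdif M X (p + 1) (mdif M X p x) = 0"
    and mact_mcar: "\<lbrakk>X \<in> obj A; Y \<in> obj A; x \<in> mcar M Y p; a \<in> hom A X Y q\<rbrakk>
        \<Longrightarrow> mact M X Y p q x a \<in> mcar M X (p + q)"
    and mact_add_left: "\<lbrakk>X \<in> obj A; Y \<in> obj A; x \<in> mcar M Y p; y \<in> mcar M Y p; a \<in> hom A X Y q\<rbrakk>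
        \<Longrightarrow> mact M X Y p q (x + y) a = mact M X Y p q x a + mact M X Y p q y a"
    and mact_add_right: "\<lbrakk>X \<in> obj A; Y \<in> obj A; x \<in> mcar M Y p; a \<in> hom A X Y q; b \<in> hom A X Y q\<rbrakk>
        \<Longrightarrow> mact M X Y p q x (a + b) = mact M X Y p q x a + mact M X Y p q x b"
    and mact_mscl: "\<lbrakk>X \<in> obj A; Y \<in> obj A; x \<in> mcar M Y p; a \<in> hom A X Y q\<rbrakk>
        \<Longrightarrow> mact M X Y p q (mscl M Y p c x) a = mscl M X (p + q) c (mact M X Y p q x a)"
    and mact_scl: "\<lbrakk>X \<in> obj A; Y \<in> obj A; x \<in> mcar M Y p; a \<in> hom A X Y q\<rbrakk>
        \<Longrightarrow> mact M X Y p q x (scl A X Y q c a) = mscl M X (p + q) c (mact M X Y p q x a)"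
    and mact_cmp:
      "\<lbrakk>X \<in> obj A; Y \<in> obj A; Z \<in> obj A; x \<in> mcar M Z p; a \<in> hom A Y Z q; b \<in> hom A X Y r\<rbrakk>
        \<Longrightarrow> mact M X Z p (q + r) x (cmp A X Y Z q r a b) = mact M X Y (p + q) r (mact M Y Z p q x a) b"
    and mact_idn: "\<lbrakk>X \<in> obj A; x \<in> mcar M X p\<rbrakk> \<Longrightarrow> mact M X X p 0 x (idn A X) = x"
    and mdif_mact: "\<lbrakk>X \<in> obj A; Y \<in> obj A; x \<in> mcar M Y p; a \<in> hom A X Y q\<rbrakk>
        \<Longrightarrow> mdif M X (p + q) (mact M X Y p q x a)
          = mact M X Y (p + 1) q (mdif M Y p x) a + sg p (mact M X Y p (q + 1) x (dif A X Y q a))"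

text \<open>
  A morphism \<open>M \<rightarrow> N\<close> of degree \<open>n\<close> is a family \<open>\<phi> X p : M(X)^p \<rightarrow> N(X)^(p+n)\<close>, extended by \<open>0\<close>
  outside the carriers so that it is determined by its values on them. The two modules may have
  elements of different types.
\<close>

definition ext0 ::
  "('k, 'o, 'm) dgcat \<Rightarrow> ('k, 'o, 'm, 'v) dgmod \<Rightarrow> ('o \<Rightarrow> int \<Rightarrow> 'v \<Rightarrow> 'w::ab_group_add) \<Rightarrow> 'o \<Rightarrow> int \<Rightarrow> 'v \<Rightarrow> 'w"
  where
  "ext0 A M \<phi> = (\<lambda>X p x. if X \<in> obj A \<and> x \<in> mcar M X p then \<phi> X p x else 0)"

definition mhom ::
  "('k, 'o, 'm) dgcat \<Rightarrow> ('k, 'o, 'm, 'v::ab_group_add) dgmod \<Rightarrow> ('k, 'o, 'm, 'w::ab_group_add) dgmod \<Rightarrow>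
   int \<Rightarrow> ('o \<Rightarrow> int \<Rightarrow> 'v \<Rightarrow> 'w) set" where
  "mhom A M N n = {\<phi>. ext0 A M \<phi> = \<phi> \<and>
     (\<forall>X\<in>obj A. \<forall>p. \<forall>x\<in>mcar M X p.
        \<phi> X p x \<in> mcar N X (p + n) \<and>
        (\<forall>y\<in>mcar M X p. \<phi> X p (x + y) = \<phi> X p x + \<phi> X p y) \<and>
        (\<forall>c. \<phi> X p (mscl M X p c x) = mscl N X (p + n) c (\<phi> X p x))) \<and>
     (\<forall>X\<in>obj A. \<forall>Y\<in>obj A. \<forall>p q. \<forall>x\<in>mcar M Y p. \<forall>a\<in>hom A X Y q.
        \<phi> X (p + q) (mact M X Y p q x a) = mact N X Y (p + n) q (\<phi> Y p x) a)}"

definition mhom_scl ::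
  "('k, 'o, 'm) dgcat \<Rightarrow> ('k, 'o, 'm, 'v) dgmod \<Rightarrow> ('k, 'o, 'm, 'w::ab_group_add) dgmod \<Rightarrow>
   int \<Rightarrow> 'k \<Rightarrow> ('o \<Rightarrow> int \<Rightarrow> 'v \<Rightarrow> 'w) \<Rightarrow> ('o \<Rightarrow> int \<Rightarrow> 'v \<Rightarrow> 'w)" where
  "mhom_scl A M N n c \<phi> = ext0 A M (\<lambda>X p x. mscl N X (p + n) c (\<phi> X p x))"

definition mhom_dif ::
  "('k, 'o, 'm) dgcat \<Rightarrow> ('k, 'o, 'm, 'v) dgmod \<Rightarrow> ('k, 'o, 'm, 'w::ab_group_add) dgmod \<Rightarrow>
   int \<Rightarrow> ('o \<Rightarrow> int \<Rightarrow> 'v \<Rightarrow> 'w) \<Rightarrow> ('o \<Rightarrow> int \<Rightarrow> 'v \<Rightarrow> 'w)" where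
  "mhom_dif A M N n \<phi> =
     ext0 A M (\<lambda>X p x. mdif N X (p + n) (\<phi> X p x) - sg n (\<phi> X (p + 1) (mdif M X p x)))"

definition mcomp ::
  "('k, 'o, 'm) dgcat \<Rightarrow> ('k, 'o, 'm, 'u) dgmod \<Rightarrow> int \<Rightarrow>
   ('o \<Rightarrow> int \<Rightarrow> 'v \<Rightarrow> 'w::ab_group_add) \<Rightarrow> ('o \<Rightarrow> int \<Rightarrow> 'u \<Rightarrow> 'v) \<Rightarrow> ('o \<Rightarrow> int \<Rightarrow> 'u \<Rightarrow> 'w)" where
  \<comment> \<open>\<open>\<psi> \<circ> \<phi>\<close> for \<open>\<phi>\<close> of degree \<open>n\<close> on \<open>L\<close>\<close>
  "mcomp A L n \<psi> \<phi> = ext0 A L (\<lambda>X p x. \<psi> X (p + n) (\<phi> X p x))"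

definition mid ::
  "('k, 'o, 'm) dgcat \<Rightarrow> ('k, 'o, 'm, 'v::ab_group_add) dgmod \<Rightarrow> ('o \<Rightarrow> int \<Rightarrow> 'v \<Rightarrow> 'v)" where
  "mid A M = ext0 A M (\<lambda>X p x. x)"

definition Cdg ::
  "('k::comm_ring_1, 'o, 'm::ab_group_add) dgcat \<Rightarrow>
   ('k, ('k, 'o, 'm, 'v::ab_group_add) dgmod, 'o \<Rightarrow> int \<Rightarrow> 'v \<Rightarrow> 'v) dgcat" where
  "Cdg A = \<lparr>obj = {M. dg_module A M}, hom = mhom A, scl = mhom_scl A, dif = mhom_dif A,
     cmp = (\<lambda>L M N m n. mcomp A L n), idn = mid A\<rparr>"

definition mod_iso ::
  "('k, 'o, 'm) dgcat \<Rightarrow> ('k, 'o, 'm, 'v::ab_group_add) dgmod \<Rightarrow> ('k, 'o, 'm, 'w::ab_group_add) dgmod \<Rightarrow> bool"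
  where
  "mod_iso A M N \<longleftrightarrow> (\<exists>\<phi>\<in>mhom A M N 0. \<exists>\<psi>\<in>mhom A N M 0.
     mhom_dif A M N 0 \<phi> = 0 \<and> mhom_dif A N M 0 \<psi> = 0 \<and>
     mcomp A M 0 \<psi> \<phi> = mid A M \<and> mcomp A N 0 \<phi> \<psi> = mid A N)"

definition rep :: "('k, 'o, 'm) dgcat \<Rightarrow> 'o \<Rightarrow> ('k, 'o, 'm, 'm) dgmod" where
  "rep A Y = \<lparr>mcar = (\<lambda>X. hom A X Y), mscl = (\<lambda>X. scl A X Y), mdif = (\<lambda>X. dif A X Y),
     mact = (\<lambda>X X'. cmp A X X' Y)\<rparr>"

definition rep_mor ::
  "('k, 'o, 'm::ab_group_add) dgcat \<Rightarrow> 'o \<Rightarrow> 'o \<Rightarrow> int \<Rightarrow> 'm \<Rightarrow> ('o \<Rightarrow> int \<Rightarrow> 'm \<Rightarrow> 'm)" where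
  "rep_mor A Y Z n f = ext0 A (rep A Y) (\<lambda>X p x. cmp A X Y Z n p f x)"

text \<open>The action of \<open>A\<close> on a shift involves no sign, since \<open>A\<close> acts on the right.\<close>

definition shift :: "int \<Rightarrow> ('k, 'o, 'm, 'v::ab_group_add) dgmod \<Rightarrow> ('k, 'o, 'm, 'v) dgmod" where
  "shift k M = \<lparr>mcar = (\<lambda>X p. mcar M X (p + k)), mscl = (\<lambda>X p. mscl M X (p + k)),
     mdif = (\<lambda>X p x. sg k (mdif M X (p + k) x)), mact = (\<lambda>X Y p q. mact M X Y (p + k) q)\<rparr>"

definition Shift ::
  "int \<Rightarrow> (('k, 'o, 'm, 'v::ab_group_add) dgmod, 'o \<Rightarrow> int \<Rightarrow> 'v \<Rightarrow> 'v,
          ('k, 'o, 'm, 'v) dgmod, 'o \<Rightarrow> int \<Rightarrow> 'v \<Rightarrow> 'v) dgfun" where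
  "Shift k = \<lparr>fob = shift k, fmor = (\<lambda>M N n \<phi> X p x. sg (k * n) (\<phi> X (p + k) x))\<rparr>"

text \<open>\<open>Cone(\<phi> : M \<rightarrow> N) = \<Sigma>M \<oplus> N\<close> with differential \<open>(x, y) \<mapsto> (-dx, \<phi> x + dy)\<close>.\<close>

definition cone ::
  "('k, 'o, 'm, 'v::ab_group_add) dgmod \<Rightarrow> ('k, 'o, 'm, 'w::ab_group_add) dgmod \<Rightarrow>
   ('o \<Rightarrow> int \<Rightarrow> 'v \<Rightarrow> 'w) \<Rightarrow> ('k, 'o, 'm, 'v \<times> 'w) dgmod" where
  "cone M N \<phi> =
     \<lparr>mcar = (\<lambda>X p. mcar M X (p + 1) \<times> mcar N X p),
      mscl = (\<lambda>X p c (x, y). (mscl M X (p + 1) c x, mscl N X p c y)),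
      mdif = (\<lambda>X p (x, y). (- mdif M X (p + 1) x, \<phi> X (p + 1) x + mdif N X p y)),
      mact = (\<lambda>X Y p q (x, y) a. (mact M X Y (p + 1) q x a, mact N X Y p q y a))\<rparr>"


section \<open>The pretriangulated hull\<close>

text \<open>
  A module obtained from representables by shifts and cones is, as a graded module, a finite direct
  sum of shifted representables, hence isomorphic to one whose elements are (finitely supported)
  sequences in \<open>'m\<close>. So the closure can be generated among modules with elements of type
  \<open>nat \<Rightarrow> 'm\<close>; a module with elements of any type belongs to \<open>pretr\<close> if it is isomorphic to one of
  these.
\<close>

inductive_set pretr_gen ::
  "('k::comm_ring_1, 'o, 'm::ab_group_add) dgcat \<Rightarrow> ('k, 'o, 'm, nat \<Rightarrow> 'm) dgmod set"
  for A where
  gen_rep: "\<lbrakk>Y \<in> obj A; dg_module A L; mod_iso A (rep A Y) L\<rbrakk> \<Longrightarrow> L \<in> pretr_gen A"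
| gen_shift: "\<lbrakk>M \<in> pretr_gen A; dg_module A L; mod_iso A (shift k M) L\<rbrakk> \<Longrightarrow> L \<in> pretr_gen A"
| gen_cone: "\<lbrakk>M \<in> pretr_gen A; N \<in> pretr_gen A; \<phi> \<in> closed0 (Cdg A) M N;
     dg_module A L; mod_iso A (cone M N \<phi>) L\<rbrakk> \<Longrightarrow> L \<in> pretr_gen A"

definition pretr ::
  "('k::comm_ring_1, 'o, 'm::ab_group_add) dgcat \<Rightarrow>
   ('k, ('k, 'o, 'm, 'v::ab_group_add) dgmod, 'o \<Rightarrow> int \<Rightarrow> 'v \<Rightarrow> 'v) dgcat" where
  "pretr A = (Cdg A) \<lparr>obj := {L. dg_module A L \<and> (\<exists>M\<in>pretr_gen A. mod_iso A M L)}\<rparr>"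

text \<open>
  Change of the type of elements of modules along an injective additive map \<open>e\<close>, an isomorphism of
  \<open>pretr A\<close> onto a full dg subcategory of \<open>pretr A\<close> at the larger type. It is needed only because
  the underlying sets of \<open>Tot\<close> and of the dual below have different types in HOL.
\<close>

definition copy :: "('v \<Rightarrow> 'u) \<Rightarrow> ('k, 'o, 'm, 'v) dgmod \<Rightarrow> ('k, 'o, 'm, 'u) dgmod" where
  "copy e M = \<lparr>mcar = (\<lambda>X p. e ` mcar M X p), mscl = (\<lambda>X p c u. e (mscl M X p c (inv e u))),
     mdif = (\<lambda>X p u. e (mdif M X p (inv e u))), mact = (\<lambda>X Y p q u a. e (mact M X Y p q (inv e u) a))\<rparr>"

definition Copy ::
  "('v \<Rightarrow> 'u::ab_group_add) \<Rightarrow>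
   (('k, 'o, 'm, 'v) dgmod, 'o \<Rightarrow> int \<Rightarrow> 'v \<Rightarrow> 'v, ('k, 'o, 'm, 'u) dgmod, 'o \<Rightarrow> int \<Rightarrow> 'u \<Rightarrow> 'u) dgfun" where
  "Copy e = \<lparr>fob = copy e,
     fmor = (\<lambda>M N n \<phi> X p u. if u \<in> range e then e (\<phi> X p (inv e u)) else 0)\<rparr>"

definition in1 :: "'v \<Rightarrow> 'v \<times> 'w::zero" where "in1 x = (x, 0)"
definition in2 :: "'w \<Rightarrow> 'v::zero \<times> 'w" where "in2 y = (0, y)"


section \<open>Duality\<close>

text \<open>
  \<open>M^\<or>(Y) = Hom(M, A(-,Y))\<close>, covariant in \<open>Y\<close>; for \<open>a \<in> A(Y,X)^q\<close> the right action of \<open>a^op\<close> is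
  \<open>\<phi> \<cdot> a^op = (-1)^(|\<phi>| q) A(-,a) \<circ> \<phi>\<close>. A morphism \<open>f : M \<rightarrow> N\<close> induces
  \<open>N^\<or> \<rightarrow> M^\<or>\<close>, \<open>\<phi> \<mapsto> (-1)^(|f| |\<phi>|) \<phi> \<circ> f\<close>.
\<close>

definition dual ::
  "('k, 'o, 'm::ab_group_add) dgcat \<Rightarrow> ('k, 'o, 'm, 'v::ab_group_add) dgmod \<Rightarrow>
   ('k, 'o, 'm, 'o \<Rightarrow> int \<Rightarrow> 'v \<Rightarrow> 'm) dgmod" where
  "dual A M =
     \<lparr>mcar = (\<lambda>Y. mhom A M (rep A Y)), mscl = (\<lambda>Y. mhom_scl A M (rep A Y)),
      mdif = (\<lambda>Y. mhom_dif A M (rep A Y)),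
      mact = (\<lambda>X Y p q \<phi> a. sg (p * q) (mcomp A M p (rep_mor A Y X q a) \<phi>))\<rparr>"

definition Dual ::
  "('k, 'o, 'm::ab_group_add) dgcat \<Rightarrow>
   (('k, 'o, 'm, 'v::ab_group_add) dgmod, 'o \<Rightarrow> int \<Rightarrow> 'v \<Rightarrow> 'v,
    ('k, 'o, 'm, 'o \<Rightarrow> int \<Rightarrow> 'v \<Rightarrow> 'm) dgmod,
    'o \<Rightarrow> int \<Rightarrow> ('o \<Rightarrow> int \<Rightarrow> 'v \<Rightarrow> 'm) \<Rightarrow> ('o \<Rightarrow> int \<Rightarrow> 'v \<Rightarrow> 'm)) dgfun" where
  \<comment> \<open>a functor on \<open>opp (pretr A)\<close>: there a morphism from \<open>N\<close> to \<open>M\<close> is an \<open>f \<in> mhom A M N n\<close>\<close>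
  "Dual A = \<lparr>fob = dual A,
     fmor = (\<lambda>N M n f. ext0 (opp A) (dual A N) (\<lambda>Y p \<phi>. sg (n * p) (mcomp A M n \<phi> f)))\<rparr>"


section \<open>Three-term complexes\<close>

datatype ('o, 'm) cpx3 = Cx (cA: 'o) (cB: 'o) (cC: 'o) (cf: 'm) (cg: 'm) (ch: 'm)

type_synonym 'm sext = "'m \<times> 'm \<times> 'm \<times> 'm \<times> 'm \<times> 'm"  \<comment> \<open>\<open>(r\<^sub>0, r\<^sub>1, r\<^sub>2, s\<^sub>1, s\<^sub>2, t)\<close>\<close>

definition cpx_obj :: "('k, 'o, 'm::ab_group_add) dgcat \<Rightarrow> ('o, 'm) cpx3 set" where
  "cpx_obj A = {Cx X Y Z f g h | X Y Z f g h.
     X \<in> obj A \<and> Y \<in> obj A \<and> Z \<in> obj A \<and> f \<in> closed0 A X Y \<and> g \<in> closed0 A Y Z \<and>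
     h \<in> hom A X Z (-1) \<and> dif A X Z (-1) h = - cmp A X Y Z 0 0 g f}"

fun cpx_hom :: "('k, 'o, 'm) dgcat \<Rightarrow> ('o, 'm) cpx3 \<Rightarrow> ('o, 'm) cpx3 \<Rightarrow> int \<Rightarrow> 'm sext set" where
  "cpx_hom A (Cx X Y Z f g h) (Cx X' Y' Z' f' g' h') n =
     hom A X X' n \<times> hom A Y Y' n \<times> hom A Z Z' n \<times>
     hom A X Y' (n - 1) \<times> hom A Y Z' (n - 1) \<times> hom A X Z' (n - 2)"

fun cpx_scl ::
  "('k, 'o, 'm) dgcat \<Rightarrow> ('o, 'm) cpx3 \<Rightarrow> ('o, 'm) cpx3 \<Rightarrow> int \<Rightarrow> 'k \<Rightarrow> 'm sext \<Rightarrow> 'm sext" where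
  "cpx_scl A (Cx X Y Z f g h) (Cx X' Y' Z' f' g' h') n c (r0, r1, r2, s1, s2, t) =
     (scl A X X' n c r0, scl A Y Y' n c r1, scl A Z Z' n c r2,
      scl A X Y' (n - 1) c s1, scl A Y Z' (n - 1) c s2, scl A X Z' (n - 2) c t)"

fun cpx_dif ::
  "('k, 'o, 'm::ab_group_add) dgcat \<Rightarrow> ('o, 'm) cpx3 \<Rightarrow> ('o, 'm) cpx3 \<Rightarrow> int \<Rightarrow> 'm sext \<Rightarrow> 'm sext" where
  "cpx_dif A (Cx X Y Z f g h) (Cx X' Y' Z' f' g' h') n (r0, r1, r2, s1, s2, t) =
     (dif A X X' n r0, dif A Y Y' n r1, dif A Z Z' n r2,
      dif A X Y' (n - 1) s1 + sg (n + 1) (cmp A X X' Y' 0 n f' r0) + sg n (cmp A X Y Y' n 0 r1 f),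
      dif A Y Z' (n - 1) s2 + sg (n + 1) (cmp A Y Y' Z' 0 n g' r1) + sg n (cmp A Y Z Z' n 0 r2 g),
      dif A X Z' (n - 2) t + sg n (cmp A X Y' Z' 0 (n - 1) g' s1) + cmp A X X' Z' (-1) n h' r0
        + sg n (cmp A X Y Z' (n - 1) 0 s2 f) + sg (n + 1) (cmp A X Z Z' n (-1) r2 h))"

fun cpx_cmp ::
  "('k, 'o, 'm::ab_group_add) dgcat \<Rightarrow> ('o, 'm) cpx3 \<Rightarrow> ('o, 'm) cpx3 \<Rightarrow> ('o, 'm) cpx3 \<Rightarrow>
   int \<Rightarrow> int \<Rightarrow> 'm sext \<Rightarrow> 'm sext \<Rightarrow> 'm sext" where
  "cpx_cmp A (Cx X Y Z f g h) (Cx X' Y' Z' f' g' h') (Cx X'' Y'' Z'' f'' g'' h'') m n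
     (r0', r1', r2', s1', s2', t') (r0, r1, r2, s1, s2, t) =
     (cmp A X X' X'' m n r0' r0, cmp A Y Y' Y'' m n r1' r1, cmp A Z Z' Z'' m n r2' r2,
      cmp A X Y' Y'' m (n - 1) r1' s1 + sg n (cmp A X X' Y'' (m - 1) n s1' r0),
      cmp A Y Z' Z'' m (n - 1) r2' s2 + sg n (cmp A Y Y' Z'' (m - 1) n s2' r1),
      cmp A X Z' Z'' m (n - 2) r2' t + cmp A X X' Z'' (m - 2) n t' r0
        + sg (n + 1) (cmp A X Y' Z'' (m - 1) (n - 1) s2' s1))"

fun cpx_idn :: "('k, 'o, 'm::ab_group_add) dgcat \<Rightarrow> ('o, 'm) cpx3 \<Rightarrow> 'm sext" where
  "cpx_idn A (Cx X Y Z f g h) = (idn A X, idn A Y, idn A Z, 0, 0, 0)"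

definition Cpx3 ::
  "('k, 'o, 'm::ab_group_add) dgcat \<Rightarrow> ('k, ('o, 'm) cpx3, 'm sext) dgcat" where
  "Cpx3 A = \<lparr>obj = cpx_obj A, hom = cpx_hom A, scl = cpx_scl A, dif = cpx_dif A, cmp = cpx_cmp A,
     idn = cpx_idn A\<rparr>"

fun op_cpx :: "('o, 'm) cpx3 \<Rightarrow> ('o, 'm) cpx3" where
  "op_cpx (Cx X Y Z f g h) = Cx Z Y X g f h"

definition Op3 :: "(('o, 'm::ab_group_add) cpx3, 'm sext, ('o, 'm) cpx3, 'm sext) dgfun" where
  "Op3 = \<lparr>fob = op_cpx,
     fmor = (\<lambda>\<xi>' \<xi> n (r0, r1, r2, s1, s2, t). (r2, r1, r0, - s2, - s1, - t))\<rparr>"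


section \<open>Totalization\<close>

fun tot :: "('k, 'o, 'm::ab_group_add) dgcat \<Rightarrow> ('o, 'm) cpx3 \<Rightarrow> ('k, 'o, 'm, ('m \<times> 'm) \<times> 'm) dgmod" where
  "tot A (Cx X Y Z f g h) =
     (let K = cone (rep A X) (rep A Y) (rep_mor A X Y 0 f)
      in cone K (rep A Z) (ext0 A K (\<lambda>V p (x, y).
           - rep_mor A X Z (-1) h V (p + 1) x + rep_mor A Y Z 0 g V p y)))"

fun tot_mor ::
  "('k, 'o, 'm::ab_group_add) dgcat \<Rightarrow> ('o, 'm) cpx3 \<Rightarrow> ('o, 'm) cpx3 \<Rightarrow> int \<Rightarrow> 'm sext \<Rightarrow>
   ('o \<Rightarrow> int \<Rightarrow> ('m \<times> 'm) \<times> 'm \<Rightarrow> ('m \<times> 'm) \<times> 'm)" where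
  "tot_mor A (Cx X Y Z f g h) (Cx X' Y' Z' f' g' h') n (r0, r1, r2, s1, s2, t) =
     ext0 A (tot A (Cx X Y Z f g h)) (\<lambda>V p ((x, y), z).
       ((rep_mor A X X' n r0 V (p + 2) x,
         sg (n + 1) (rep_mor A X Y' (n - 1) s1 V (p + 2) x) + sg n (rep_mor A Y Y' n r1 V (p + 1) y)),
        - rep_mor A X Z' (n - 2) t V (p + 2) x - rep_mor A Y Z' (n - 1) s2 V (p + 1) y
          + rep_mor A Z Z' n r2 V p z))"

definition Tot ::
  "('k, 'o, 'm::ab_group_add) dgcat \<Rightarrow>
   (('o, 'm) cpx3, 'm sext, ('k, 'o, 'm, ('m \<times> 'm) \<times> 'm) dgmod,
    'o \<Rightarrow> int \<Rightarrow> ('m \<times> 'm) \<times> 'm \<Rightarrow> ('m \<times> 'm) \<times> 'm) dgfun" where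
  "Tot A = \<lparr>fob = tot A, fmor = tot_mor A\<rparr>"

end

theory Submission
  imports Defs
begin

text \<open>
  By the Yoneda lemma a morphism from \<open>\<Sigma>\<^sup>2X \<oplus> \<Sigma>Y \<oplus> Z\<close> to the representable module of \<open>V\<close> is given by
  three elements of \<open>A(X,V)\<close>, \<open>A(Y,V)\<close>, \<open>A(Z,V)\<close>, and \<open>Tot(\<xi>\<^sup>o\<^sup>p)(V)\<close> consists of exactly such triples. In
  degree \<open>p\<close> the triple \<open>(x', y', z')\<close> is sent to \<open>(x, y, z) \<mapsto> z'x + (-1)\<^sup>p y'y - x'z\<close>, which respects
  differentials and actions and is natural in \<open>\<xi>\<close>. Since \<open>Tot(\<xi>\<^sup>o\<^sup>p)\<close> is an iterated cone of
  representables and \<open>pretr\<close> is closed under isomorphisms, this also shows that \<open>\<Sigma>\<^sup>2(M\<^sub>\<xi>)\<^sup>\<or>\<close> lies in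
  \<open>pretr\<close>; functoriality of duality can therefore be checked on all dg modules.
\<close>

section \<open>Dg categories, modules and morphisms\<close>

text \<open>What shapes the proof is that nothing is total: Hom groups and module pieces are
  subgroups of an ambient type, every operation carries its objects and degrees as arguments, and a
  morphism is a function vanishing off the carriers. So linearity is always relative to a carrier,
  equal degrees written differently (\<open>p + 1 + n\<close>, \<open>p + n + 1\<close>) must be
  identified before terms match, and maps are compared through their \<open>ext0\<close> normal
  form. Signs are settled by splitting on the parities of the degrees. The two functors moreover
  produce modules with elements of different types; the isomorphism is therefore built between the
  original modules and only afterwards transported along \<open>in1\<close> and
  \<open>in2\<close>.\<close>

lemma kmoduleD:
  assumes "kmodule V s"
  shows "0 \<in> V" "x \<in> V \<Longrightarrow> y \<in> V \<Longrightarrow> x + y \<in> V" "x \<in> V \<Longrightarrow> - x \<in> V" "x \<in> V \<Longrightarrow> s c x \<in> V"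
    "x \<in> V \<Longrightarrow> y \<in> V \<Longrightarrow> s c (x + y) = s c x + s c y"
    "x \<in> V \<Longrightarrow> s (c + d) x = s c x + s d x" "x \<in> V \<Longrightarrow> s (c * d) x = s c (s d x)"
    "x \<in> V \<Longrightarrow> s 1 x = x"
  using assms unfolding kmodule_def by blast+

lemma kmodule_diff: "kmodule V s \<Longrightarrow> x \<in> V \<Longrightarrow> y \<in> V \<Longrightarrow> x - y \<in> V"
  using kmoduleD(2,3)[of V s] by (metis diff_conv_add_uminus)

lemma kmodule_sg: "kmodule V s \<Longrightarrow> x \<in> V \<Longrightarrow> sg n x \<in> V"
  by (simp add: sg_def kmoduleD)

lemma additive_on_zero:
  fixes f :: "'a::ab_group_add \<Rightarrow> 'b::ab_group_add"
  assumes "kmodule V s" "\<And>x y. x \<in> V \<Longrightarrow> y \<in> V \<Longrightarrow> f (x + y) = f x + f y"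
  shows "f 0 = 0"
  using assms(2)[of 0 0] kmoduleD(1)[OF assms(1)] by simp

lemma additive_on_minus:
  fixes f :: "'a::ab_group_add \<Rightarrow> 'b::ab_group_add"
  assumes "kmodule V s" "\<And>x y. x \<in> V \<Longrightarrow> y \<in> V \<Longrightarrow> f (x + y) = f x + f y" "x \<in> V"
  shows "f (- x) = - f x"
  using assms(2)[of x "- x"] kmoduleD(3)[OF assms(1)] assms(3) additive_on_zero[of V s f] assms(1,2)
  by (simp add: eq_neg_iff_add_eq_0 add.commute)

lemma additive_on_diff:
  fixes f :: "'a::ab_group_add \<Rightarrow> 'b::ab_group_add"
  assumes "kmodule V s" "\<And>x y. x \<in> V \<Longrightarrow> y \<in> V \<Longrightarrow> f (x + y) = f x + f y" "x \<in> V" "y \<in> V"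
  shows "f (x - y) = f x - f y"
  using assms(2)[of "x - y" y] kmodule_diff[OF assms(1,3,4)] assms(4) by (simp add: eq_diff_eq)

lemma kmodule_scl_zero: "kmodule V s \<Longrightarrow> s c 0 = 0"
  by (rule additive_on_zero[of V s]) (auto simp: kmoduleD)

lemma kmodule_scl_minus: "kmodule V s \<Longrightarrow> x \<in> V \<Longrightarrow> s c (- x) = - s c x"
  by (rule additive_on_minus[of V s]) (auto simp: kmoduleD)

lemma kmodule_scl_diff: "kmodule V s \<Longrightarrow> x \<in> V \<Longrightarrow> y \<in> V \<Longrightarrow> s c (x - y) = s c x - s c y"
  by (rule additive_on_diff[of V s]) (auto simp: kmoduleD)

context dg_category
begin

lemmas hom_mem = hom_kmodule[THEN kmoduleD(1)] hom_kmodule[THEN kmoduleD(2)] hom_kmodule[THEN kmoduleD(3)]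
  hom_kmodule[THEN kmoduleD(4)] hom_kmodule[THEN kmodule_diff] hom_kmodule[THEN kmodule_sg]

declare hom_mem [simp]

lemmas scl_rules = hom_kmodule[THEN kmoduleD(5)] hom_kmodule[THEN kmodule_scl_zero] hom_kmodule[THEN kmodule_scl_minus]
  hom_kmodule[THEN kmodule_scl_diff]

declare scl_rules [simp]

text \<open>The degree of the result is a free \<open>k\<close> with an equation, so that the rule
  applies in whatever form the sum of degrees is written. The primed rules below follow the same
  pattern.\<close>

lemma dif_in [simp]:
  "\<lbrakk>X \<in> obj A; Y \<in> obj A; f \<in> hom A X Y n; k = n + 1\<rbrakk> \<Longrightarrow> dif A X Y n f \<in> hom A X Y k"
  by (simp add: dif_hom)

lemma cmp_in [simp]:
  "\<lbrakk>X \<in> obj A; Y \<in> obj A; Z \<in> obj A; g \<in> hom A Y Z m; f \<in> hom A X Y n; k = m + n\<rbrakk>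
    \<Longrightarrow> cmp A X Y Z m n g f \<in> hom A X Z k"
  by (simp add: cmp_hom)

lemma dif_zero [simp]: "\<lbrakk>X \<in> obj A; Y \<in> obj A\<rbrakk> \<Longrightarrow> dif A X Y n 0 = 0"
  by (rule additive_on_zero[OF hom_kmodule[of X Y n]]) (auto simp: dif_add)

lemma dif_minus [simp]: "\<lbrakk>X \<in> obj A; Y \<in> obj A; f \<in> hom A X Y n\<rbrakk> \<Longrightarrow> dif A X Y n (- f) = - dif A X Y n f"
  by (rule additive_on_minus[OF hom_kmodule[of X Y n]]) (auto simp: dif_add)

lemma cmp_zero_left [simp]:
  "\<lbrakk>X \<in> obj A; Y \<in> obj A; Z \<in> obj A; f \<in> hom A X Y n\<rbrakk> \<Longrightarrow> cmp A X Y Z m n 0 f = 0"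
  by (rule additive_on_zero[OF hom_kmodule[of Y Z m], where f="\<lambda>g. cmp A X Y Z m n g f"])
    (auto simp: cmp_add_left)

lemma cmp_zero_right [simp]:
  "\<lbrakk>X \<in> obj A; Y \<in> obj A; Z \<in> obj A; g \<in> hom A Y Z m\<rbrakk> \<Longrightarrow> cmp A X Y Z m n g 0 = 0"
  by (rule additive_on_zero[OF hom_kmodule[of X Y n], where f="\<lambda>f. cmp A X Y Z m n g f"])
    (auto simp: cmp_add_right)

lemma cmp_minus_left [simp]:
  "\<lbrakk>X \<in> obj A; Y \<in> obj A; Z \<in> obj A; g \<in> hom A Y Z m; f \<in> hom A X Y n\<rbrakk>
    \<Longrightarrow> cmp A X Y Z m n (- g) f = - cmp A X Y Z m n g f"
  by (rule additive_on_minus[OF hom_kmodule[of Y Z m], where f="\<lambda>g. cmp A X Y Z m n g f"])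
    (auto simp: cmp_add_left)

lemma cmp_minus_right [simp]:
  "\<lbrakk>X \<in> obj A; Y \<in> obj A; Z \<in> obj A; g \<in> hom A Y Z m; f \<in> hom A X Y n\<rbrakk>
    \<Longrightarrow> cmp A X Y Z m n g (- f) = - cmp A X Y Z m n g f"
  by (rule additive_on_minus[OF hom_kmodule[of X Y n], where f="\<lambda>f. cmp A X Y Z m n g f"])
    (auto simp: cmp_add_right)

lemma dif_diff [simp]: "\<lbrakk>X \<in> obj A; Y \<in> obj A; f \<in> hom A X Y n; f' \<in> hom A X Y n\<rbrakk>
    \<Longrightarrow> dif A X Y n (f - f') = dif A X Y n f - dif A X Y n f'"
  by (rule additive_on_diff[OF hom_kmodule[of X Y n]]) (auto simp: dif_add)

lemma cmp_diff_left [simp]: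
  "\<lbrakk>X \<in> obj A; Y \<in> obj A; Z \<in> obj A; g \<in> hom A Y Z m; g' \<in> hom A Y Z m; f \<in> hom A X Y n\<rbrakk>
    \<Longrightarrow> cmp A X Y Z m n (g - g') f = cmp A X Y Z m n g f - cmp A X Y Z m n g' f"
  by (rule additive_on_diff[OF hom_kmodule[of Y Z m], where f="\<lambda>g. cmp A X Y Z m n g f"])
    (auto simp: cmp_add_left)

lemma cmp_diff_right [simp]:
  "\<lbrakk>X \<in> obj A; Y \<in> obj A; Z \<in> obj A; g \<in> hom A Y Z m; f \<in> hom A X Y n; f' \<in> hom A X Y n\<rbrakk>
    \<Longrightarrow> cmp A X Y Z m n g (f - f') = cmp A X Y Z m n g f - cmp A X Y Z m n g f'"
  by (rule additive_on_diff[OF hom_kmodule[of X Y n], where f="\<lambda>f. cmp A X Y Z m n g f"])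
    (auto simp: cmp_add_right)

declare dif_add [simp] cmp_add_left [simp] cmp_add_right [simp] dif_scl [simp] cmp_scl_left [simp]
  cmp_scl_right [simp] idn_hom [simp] cmp_idn_left [simp] cmp_idn_right [simp]

lemma dif_dif' [simp]:
  "\<lbrakk>X \<in> obj A; Y \<in> obj A; f \<in> hom A X Y n; k = n + 1\<rbrakk> \<Longrightarrow> dif A X Y k (dif A X Y n f) = 0"
  by (simp add: dif_dif)

lemma assoc:
  "\<lbrakk>W \<in> obj A; X \<in> obj A; Y \<in> obj A; Z \<in> obj A;
    h \<in> hom A Y Z l; g \<in> hom A X Y m; f \<in> hom A W X n; k = l + m\<rbrakk>
    \<Longrightarrow> cmp A W X Z k n (cmp A X Y Z l m h g) f
      = cmp A W Y Z l (m + n) h (cmp A W X Y m n g f)"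
  by (simp add: cmp_assoc)

lemma dif_cmp':
  "\<lbrakk>X \<in> obj A; Y \<in> obj A; Z \<in> obj A; g \<in> hom A Y Z m; f \<in> hom A X Y n; k = m + n\<rbrakk>
    \<Longrightarrow> dif A X Z k (cmp A X Y Z m n g f)
      = cmp A X Y Z (m + 1) n (dif A Y Z m g) f + sg m (cmp A X Y Z m (n + 1) g (dif A X Y n f))"
  by (simp add: dif_cmp)

end

section \<open>Opposite dg categories\<close>

lemma opp_sel [simp]:
  "obj (opp A) = obj A" "hom (opp A) X Y n = hom A Y X n" "scl (opp A) X Y n = scl A Y X n"
  "dif (opp A) X Y n = dif A Y X n" "cmp (opp A) X Y Z m n a b = sg (m * n) (cmp A Z Y X n m b a)"
  "idn (opp A) = idn A"
  by (simp_all add: opp_def)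

lemma dg_category_opp:
  assumes "dg_category A"
  shows "dg_category (opp A)"
proof -
  interpret dg_category A by fact
  show ?thesis
  proof (unfold_locales, goal_cases)
    \<comment> \<open>Associativity: both bracketings carry the sign
      \<open>(-1)^(l m + l n + m n)\<close>.\<close>
    case (11 W X Y Z h l g m f n)
    then show ?case
      by (cases "even m"; cases "even n"; cases "even l"; simp add: sg_def assoc add.commute)
  next
    \<comment> \<open>The two Leibniz terms trade places; the signs \<open>(-1)^((m + 1) n)\<close>
      and \<open>(-1)^(m + m (n + 1))\<close> of the opposite composites make up for it.\<close>
    case (12 X Y Z g m f n)
    then show ?case
      by (cases "even m"; cases "even n"; simp add: sg_def dif_cmp' add.commute)
  qed (simp_all add: hom_kmodule sg_def add.commute)
qed

section \<open>Right dg modules\<close>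

context dg_module
begin

lemmas mcar_mem = mcar_kmodule[THEN kmoduleD(1)] mcar_kmodule[THEN kmoduleD(2)]
  mcar_kmodule[THEN kmoduleD(3)] mcar_kmodule[THEN kmoduleD(4)] mcar_kmodule[THEN kmodule_diff]
  mcar_kmodule[THEN kmodule_sg]

lemmas mscl_rules = mcar_kmodule[THEN kmoduleD(5)] mcar_kmodule[THEN kmodule_scl_zero]
  mcar_kmodule[THEN kmodule_scl_minus] mcar_kmodule[THEN kmodule_scl_diff]

declare mcar_mem [simp] mscl_rules [simp]

lemma mdif_in [simp]:
  "\<lbrakk>X \<in> obj A; x \<in> mcar M X p; k = p + 1\<rbrakk> \<Longrightarrow> mdif M X p x \<in> mcar M X k"
  by (simp add: mdif_mcar)

lemma mact_in [simp]:
  "\<lbrakk>X \<in> obj A; Y \<in> obj A; x \<in> mcar M Y p; a \<in> hom A X Y q; k = p + q\<rbrakk>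
    \<Longrightarrow> mact M X Y p q x a \<in> mcar M X k"
  by (simp add: mact_mcar)

lemma mdif_zero [simp]: "X \<in> obj A \<Longrightarrow> mdif M X p 0 = 0"
  by (rule additive_on_zero[OF mcar_kmodule[of X p]]) (auto simp: mdif_add)

lemma mdif_minus [simp]: "\<lbrakk>X \<in> obj A; x \<in> mcar M X p\<rbrakk> \<Longrightarrow> mdif M X p (- x) = - mdif M X p x"
  by (rule additive_on_minus[OF mcar_kmodule[of X p]]) (auto simp: mdif_add)

lemma mact_minus_left [simp]:
  "\<lbrakk>X \<in> obj A; Y \<in> obj A; x \<in> mcar M Y p; a \<in> hom A X Y q\<rbrakk>
    \<Longrightarrow> mact M X Y p q (- x) a = - mact M X Y p q x a"
  by (rule additive_on_minus[OF mcar_kmodule[of Y p], where f="\<lambda>x. mact M X Y p q x a"])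
    (auto simp: mact_add_left)

lemma mact_zero_left [simp]:
  "\<lbrakk>X \<in> obj A; Y \<in> obj A; a \<in> hom A X Y q\<rbrakk> \<Longrightarrow> mact M X Y p q 0 a = 0"
  by (rule additive_on_zero[OF mcar_kmodule[of Y p], where f="\<lambda>x. mact M X Y p q x a"])
    (auto simp: mact_add_left)

lemma mdif_diff [simp]: "\<lbrakk>X \<in> obj A; x \<in> mcar M X p; y \<in> mcar M X p\<rbrakk>
    \<Longrightarrow> mdif M X p (x - y) = mdif M X p x - mdif M X p y"
  by (rule additive_on_diff[OF mcar_kmodule[of X p]]) (auto simp: mdif_add)

lemma mact_diff_left [simp]:
  "\<lbrakk>X \<in> obj A; Y \<in> obj A; x \<in> mcar M Y p; y \<in> mcar M Y p; a \<in> hom A X Y q\<rbrakk>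
    \<Longrightarrow> mact M X Y p q (x - y) a = mact M X Y p q x a - mact M X Y p q y a"
  by (rule additive_on_diff[OF mcar_kmodule[of Y p], where f="\<lambda>x. mact M X Y p q x a"])
    (auto simp: mact_add_left)

declare mdif_add [simp] mdif_mscl [simp] mact_add_left [simp] mact_add_right [simp] mact_mscl [simp]
  mact_scl [simp] mact_idn [simp]

lemma mdif_mdif' [simp]: "\<lbrakk>X \<in> obj A; x \<in> mcar M X p; k = p + 1\<rbrakk> \<Longrightarrow> mdif M X k (mdif M X p x) = 0"
  by (simp add: mdif_mdif)

lemma mact_cmp':
  "\<lbrakk>X \<in> obj A; Y \<in> obj A; Z \<in> obj A; x \<in> mcar M Z p; a \<in> hom A Y Z q; b \<in> hom A X Y r; k = q + r\<rbrakk>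
    \<Longrightarrow> mact M X Z p k x (cmp A X Y Z q r a b) = mact M X Y (p + q) r (mact M Y Z p q x a) b"
  by (simp add: mact_cmp)

lemma mdif_mact':
  "\<lbrakk>X \<in> obj A; Y \<in> obj A; x \<in> mcar M Y p; a \<in> hom A X Y q; k = p + q\<rbrakk>
    \<Longrightarrow> mdif M X k (mact M X Y p q x a)
      = mact M X Y (p + 1) q (mdif M Y p x) a + sg p (mact M X Y p (q + 1) x (dif A X Y q a))"
  by (simp add: mdif_mact)

end

section \<open>Morphisms of dg modules\<close>

lemma ext0_in [simp]: "\<lbrakk>X \<in> obj A; x \<in> mcar M X p\<rbrakk> \<Longrightarrow> ext0 A M \<phi> X p x = \<phi> X p x"
  by (simp add: ext0_def)

lemma ext0_out: "\<not> (X \<in> obj A \<and> x \<in> mcar M X p) \<Longrightarrow> ext0 A M \<phi> X p x = 0"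
  by (auto simp: ext0_def)

lemma ext0_idem [simp]: "ext0 A M (ext0 A M \<phi>) = ext0 A M \<phi>"
  by (simp add: ext0_def fun_eq_iff)

lemma ext0_eqI:
  assumes "\<And>X p x. X \<in> obj A \<Longrightarrow> x \<in> mcar M X p \<Longrightarrow> \<phi> X p x = \<psi> X p x"
  shows "ext0 A M \<phi> = ext0 A M \<psi>"
  using assms by (auto simp: ext0_def fun_eq_iff)

lemma ext0_arith:
  fixes \<phi> \<psi> :: "'o \<Rightarrow> int \<Rightarrow> 'v \<Rightarrow> 'w::ab_group_add"
  shows "ext0 A M (\<phi> + \<psi>) = ext0 A M \<phi> + ext0 A M \<psi>" "ext0 A M (- \<phi>) = - ext0 A M \<phi>"
    "ext0 A M (0 :: 'o \<Rightarrow> int \<Rightarrow> 'v \<Rightarrow> 'w) = 0"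
  by (auto simp: ext0_def fun_eq_iff)

lemma sg_apply [simp]: "sg n \<phi> x = sg n (\<phi> x)"
  by (simp add: sg_def)

locale dg_morphism = M: dg_module A M + N: dg_module A N
  for A :: "('k::comm_ring_1, 'o, 'm::ab_group_add) dgcat"
    and M :: "('k, 'o, 'm, 'v::ab_group_add) dgmod" and N :: "('k, 'o, 'm, 'w::ab_group_add) dgmod" +
  fixes n :: int and \<phi> :: "'o \<Rightarrow> int \<Rightarrow> 'v \<Rightarrow> 'w"
  assumes mhom: "\<phi> \<in> mhom A M N n"
begin

lemma ext0 [simp]: "ext0 A M \<phi> = \<phi>"
  using mhom unfolding mhom_def by simp

lemma out: "\<not> (X \<in> obj A \<and> x \<in> mcar M X p) \<Longrightarrow> \<phi> X p x = 0"
  using ext0_out[of X A x M p \<phi>] by simp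

lemma mem [simp]: "\<lbrakk>X \<in> obj A; x \<in> mcar M X p; k = p + n\<rbrakk> \<Longrightarrow> \<phi> X p x \<in> mcar N X k"
  using mhom unfolding mhom_def by simp

lemma add [simp]: "\<lbrakk>X \<in> obj A; x \<in> mcar M X p; y \<in> mcar M X p\<rbrakk> \<Longrightarrow> \<phi> X p (x + y) = \<phi> X p x + \<phi> X p y"
  using mhom unfolding mhom_def by simp

lemma scl [simp]: "\<lbrakk>X \<in> obj A; x \<in> mcar M X p\<rbrakk> \<Longrightarrow> \<phi> X p (mscl M X p c x) = mscl N X (p + n) c (\<phi> X p x)"
  using mhom unfolding mhom_def by simp

lemma act [simp]:
  "\<lbrakk>X \<in> obj A; Y \<in> obj A; x \<in> mcar M Y p; a \<in> hom A X Y q; k = p + q\<rbrakk>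
    \<Longrightarrow> \<phi> X k (mact M X Y p q x a) = mact N X Y (p + n) q (\<phi> Y p x) a"
  using mhom unfolding mhom_def by simp

lemma zero [simp]: "\<phi> X p 0 = 0"
  by (cases "X \<in> obj A") (auto intro: additive_on_zero[OF M.mcar_kmodule[of X p]] simp: out)

lemma minus [simp]: "\<lbrakk>X \<in> obj A; x \<in> mcar M X p\<rbrakk> \<Longrightarrow> \<phi> X p (- x) = - \<phi> X p x"
  by (rule additive_on_minus[OF M.mcar_kmodule[of X p]]) auto

lemma diff [simp]: "\<lbrakk>X \<in> obj A; x \<in> mcar M X p; y \<in> mcar M X p\<rbrakk> \<Longrightarrow> \<phi> X p (x - y) = \<phi> X p x - \<phi> X p y"
  by (rule additive_on_diff[OF M.mcar_kmodule[of X p]]) auto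

lemma sg [simp]: "\<lbrakk>X \<in> obj A; x \<in> mcar M X p\<rbrakk> \<Longrightarrow> \<phi> X p (sg l x) = sg l (\<phi> X p x)"
  by (simp add: sg_def)

end

lemma dg_morphism_iff:
  "dg_morphism A M N n \<phi> \<longleftrightarrow> dg_module A M \<and> dg_module A N \<and> \<phi> \<in> mhom A M N n"
  by (simp add: dg_morphism_def dg_morphism_axioms_def)

text \<open>Turns a formula that is meaningful only on the carriers into a morphism; this is how all
  concrete morphisms below are obtained.\<close>

lemma ext0_mhom:
  assumes "\<And>X p x. \<lbrakk>X \<in> obj A; x \<in> mcar M X p\<rbrakk> \<Longrightarrow> \<phi> X p x \<in> mcar N X (p + n)"
    and "\<And>X p x y. \<lbrakk>X \<in> obj A; x \<in> mcar M X p; y \<in> mcar M X p\<rbrakk> \<Longrightarrow> \<phi> X p (x + y) = \<phi> X p x + \<phi> X p y"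
    and "\<And>X p x c. \<lbrakk>X \<in> obj A; x \<in> mcar M X p\<rbrakk> \<Longrightarrow> \<phi> X p (mscl M X p c x) = mscl N X (p + n) c (\<phi> X p x)"
    and "\<And>X Y p q x a. \<lbrakk>X \<in> obj A; Y \<in> obj A; x \<in> mcar M Y p; a \<in> hom A X Y q\<rbrakk>
      \<Longrightarrow> \<phi> X (p + q) (mact M X Y p q x a) = mact N X Y (p + n) q (\<phi> Y p x) a"
    and "dg_module A M"
  shows "ext0 A M \<phi> \<in> mhom A M N n"
proof -
  interpret dg_module A M by fact
  show ?thesis
    unfolding mhom_def using assms(1-4) by (auto simp: mact_mcar)
qed

lemma mhom_eqI:
  assumes "\<phi> \<in> mhom A M N n" "\<psi> \<in> mhom A M N n"
    and "\<And>X p x. X \<in> obj A \<Longrightarrow> x \<in> mcar M X p \<Longrightarrow> \<phi> X p x = \<psi> X p x"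
  shows "\<phi> = \<psi>"
proof -
  have "ext0 A M \<phi> = \<phi>" "ext0 A M \<psi> = \<psi>" using assms(1,2) unfolding mhom_def by auto
  then show ?thesis using ext0_eqI[of A M \<phi> \<psi>] assms(3) by metis
qed

lemma mcomp_mhom:
  assumes "dg_module A L" "dg_module A M" "dg_module A N" "\<phi> \<in> mhom A L M n" "\<psi> \<in> mhom A M N m" "k
    = m + n"
  shows "mcomp A L n \<psi> \<phi> \<in> mhom A L N k"
proof -
  interpret P: dg_morphism A L M n \<phi> using assms by (simp add: dg_morphism_iff)
  interpret Q: dg_morphism A M N m \<psi> using assms by (simp add: dg_morphism_iff)
  show ?thesis
    unfolding mcomp_def by (rule ext0_mhom) (simp_all add: ac_simps \<open>k = m + n\<close> P.M.dg_module_axioms)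
qed

lemma mhom_dif_mhom:
  assumes "dg_module A M" "dg_module A N" "\<phi> \<in> mhom A M N n" "k = n + 1"
  shows "mhom_dif A M N n \<phi> \<in> mhom A M N k"
proof -
  interpret P: dg_morphism A M N n \<phi> using assms by (simp add: dg_morphism_iff)
  show ?thesis
    unfolding mhom_dif_def
  proof (rule ext0_mhom, goal_cases)
    \<comment> \<open>Compatibility with the action: the two terms containing \<open>dif a\<close>
      both have the sign \<open>(-1)^(p + n)\<close> and cancel.\<close>
    case (4 X Y p q x a)
    then show ?case
      by (cases "even p"; cases "even n";
        simp add: P.M.mdif_mact' P.N.mdif_mact' sg_def algebra_simps \<open>k = n + 1\<close>
          flip: diff_conv_add_uminus)
  qed (simp_all add: ac_simps \<open>k = n + 1\<close> P.M.dg_module_axioms sg_def)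
qed

section \<open>Representables, shifts and cones\<close>

lemma rep_sel [simp]:
  "mcar (rep A Y) X p = hom A X Y p" "mscl (rep A Y) X p = scl A X Y p" "mdif (rep A Y) X p
    = dif A X Y p"
  "mact (rep A Y) X X' p q = cmp A X X' Y p q"
  by (simp_all add: rep_def)

lemma (in dg_category) dg_module_rep [simp]: "Y \<in> obj A \<Longrightarrow> dg_module A (rep A Y)"
  by unfold_locales (simp_all add: hom_kmodule assoc dif_cmp')

lemma rep_mor_eq [simp]: "\<lbrakk>V \<in> obj A; x \<in> hom A V Y p\<rbrakk> \<Longrightarrow> rep_mor A Y Z n f V p x = cmp A V Y Z n p f x"
  by (simp add: rep_mor_def)

lemma (in dg_category) rep_mor_mhom:
  "\<lbrakk>Y \<in> obj A; Z \<in> obj A; f \<in> hom A Y Z n\<rbrakk> \<Longrightarrow> rep_mor A Y Z n f \<in> mhom A (rep A Y) (rep A Z) n"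
  unfolding rep_mor_def by (rule ext0_mhom) (simp_all add: assoc add.commute)

lemma shift_sel [simp]:
  "mcar (shift k M) X p = mcar M X (p + k)" "mscl (shift k M) X p = mscl M X (p + k)"
  "mdif (shift k M) X p x = sg k (mdif M X (p + k) x)" "mact (shift k M) X Y p q = mact M X Y (p + k) q"
  by (simp_all add: shift_def)

lemma (in dg_module) dg_module_shift: "dg_module A (shift k M)"
proof (unfold_locales, goal_cases)
  \<comment> \<open>The factor \<open>(-1)^k\<close> in the shifted differential turns the Leibniz
    sign \<open>(-1)^(p + k)\<close> into the required \<open>(-1)^p\<close>, which is why the
    action itself needs no sign.\<close>
  case (13 X Y x p a q)
  then show ?case
    by (cases "even p"; cases "even k"; simp add: sg_def mdif_mact' ac_simps)
qed (simp_all add: mcar_kmodule sg_def mact_cmp' ac_simps)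

lemma cone_sel [simp]:
  "mcar (cone M N \<phi>) X p = mcar M X (p + 1) \<times> mcar N X p"
  "mscl (cone M N \<phi>) X p c (x, y) = (mscl M X (p + 1) c x, mscl N X p c y)"
  "mdif (cone M N \<phi>) X p (x, y) = (- mdif M X (p + 1) x, \<phi> X (p + 1) x + mdif N X p y)"
  "mact (cone M N \<phi>) X Y p q (x, y) a = (mact M X Y (p + 1) q x a, mact N X Y p q y a)"
  by (simp_all add: cone_def)

lemma closed_morphism_dif:
  assumes "mhom_dif A M N n \<phi> = 0" "X \<in> obj A" "x \<in> mcar M X p" "k = p + 1"
  shows "\<phi> X k (mdif M X p x) = sg n (mdif N X (p + n) (\<phi> X p x))"
proof -
  have "mhom_dif A M N n \<phi> X p x = 0" using assms(1) by simp
  then show ?thesis using assms(2-) unfolding mhom_dif_def by (auto simp: sg_def split: if_splits)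
qed

lemma dg_module_cone:
  assumes "dg_module A M" "dg_module A N" "\<phi> \<in> mhom A M N 0" "mhom_dif A M N 0 \<phi> = 0"
  shows "dg_module A (cone M N \<phi>)"
proof -
  interpret P: dg_morphism A M N 0 \<phi> using assms by (simp add: dg_morphism_iff)
  note [simp] = closed_morphism_dif[OF assms(4)]
  show ?thesis
  proof (unfold_locales, goal_cases)
    case (1 X p)
    show ?case
      unfolding kmodule_def using P.M.mcar_kmodule[OF 1, of "p + 1"] P.N.mcar_kmodule[OF 1, of p]
      by (auto simp: zero_prod_def kmoduleD)
  next
    \<comment> \<open>Off the diagonal the square of the differential is
      \<open>d \<phi> - \<phi> d\<close>, which vanishes because \<phi> is closed.\<close>
    case (5 X x p)
    then show ?case by (auto simp: zero_prod_def sg_def)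
  next
    case (13 X Y x p a q)
    then show ?case
      by (cases "even p"; auto simp: sg_def P.M.mdif_mact' P.N.mdif_mact' ac_simps)
  qed (auto simp: P.M.mact_cmp' P.N.mact_cmp' ac_simps)
qed

section \<open>Isomorphisms of dg modules\<close>

text \<open>Keeps both maps of a \<open>mod_iso\<close> explicit, since they are transported along
  copies and finally serve as the components of the natural isomorphism and its inverse.\<close>

definition iso_pair where
  "iso_pair A M N \<phi> \<psi> \<longleftrightarrow> \<phi> \<in> mhom A M N 0 \<and> \<psi> \<in> mhom A N M 0 \<and>
     mhom_dif A M N 0 \<phi> = 0 \<and> mhom_dif A N M 0 \<psi> = 0 \<and>
     mcomp A M 0 \<psi> \<phi> = mid A M \<and> mcomp A N 0 \<phi> \<psi> = mid A N"

lemma mod_iso_iff: "mod_iso A M N \<longleftrightarrow> (\<exists>\<phi> \<psi>. iso_pair A M N \<phi> \<psi>)"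
  unfolding mod_iso_def iso_pair_def by blast

lemma iso_pair_sym: "iso_pair A M N \<phi> \<psi> \<Longrightarrow> iso_pair A N M \<psi> \<phi>"
  unfolding iso_pair_def by blast

lemma iso_pairD:
  assumes "iso_pair A M N \<phi> \<psi>" "X \<in> obj A" "x \<in> mcar M X p"
  shows "\<psi> X p (\<phi> X p x) = x" "k = p + 1 \<Longrightarrow> \<phi> X k (mdif M X p x) = mdif N X p (\<phi> X p x)"
proof -
  have "mcomp A M 0 \<psi> \<phi> X p x = mid A M X p x" using assms(1) unfolding iso_pair_def by simp
  then show "\<psi> X p (\<phi> X p x) = x" using assms by (simp add: mcomp_def mid_def)
  show "k = p + 1 \<Longrightarrow> \<phi> X k (mdif M X p x) = mdif N X p (\<phi> X p x)"
    using closed_morphism_dif[of A M N 0 \<phi> X x p] assms unfolding iso_pair_def by (simp add: sg_def)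
qed

text \<open>A two-sided inverse of a bijective morphism inherits linearity, action and differential
  by injectivity. So structure is demanded of \<open>f\<close> only, and of \<open>g\<close> only
  that it maps carriers to carriers and inverts \<open>f\<close>.\<close>

lemma iso_pairI:
  assumes "dg_module A M" "dg_module A N"
    and f: "\<And>X p x. \<lbrakk>X \<in> obj A; x \<in> mcar M X p\<rbrakk> \<Longrightarrow> f X p x \<in> mcar N X p"
    and f_add: "\<And>X p x y. \<lbrakk>X \<in> obj A; x \<in> mcar M X p; y \<in> mcar M X p\<rbrakk> \<Longrightarrow> f X p (x + y)
      = f X p x + f X p y"
    and f_scl: "\<And>X p x c. \<lbrakk>X \<in> obj A; x \<in> mcar M X p\<rbrakk> \<Longrightarrow> f X p (mscl M X p c x) = mscl N X p c (f X p x)"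
    and f_act: "\<And>X Y p q x a. \<lbrakk>X \<in> obj A; Y \<in> obj A; x \<in> mcar M Y p; a \<in> hom A X Y q\<rbrakk>
      \<Longrightarrow> f X (p + q) (mact M X Y p q x a) = mact N X Y p q (f Y p x) a"
    and f_dif: "\<And>X p x. \<lbrakk>X \<in> obj A; x \<in> mcar M X p\<rbrakk> \<Longrightarrow> f X (p + 1) (mdif M X p x) = mdif N X p (f X p x)"
    and g: "\<And>X p y. \<lbrakk>X \<in> obj A; y \<in> mcar N X p\<rbrakk> \<Longrightarrow> g X p y \<in> mcar M X p"
    and fg: "\<And>X p y. \<lbrakk>X \<in> obj A; y \<in> mcar N X p\<rbrakk> \<Longrightarrow> f X p (g X p y) = y"
    and gf: "\<And>X p x. \<lbrakk>X \<in> obj A; x \<in> mcar M X p\<rbrakk> \<Longrightarrow> g X p (f X p x) = x"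
  shows "iso_pair A M N (ext0 A M f) (ext0 A N g)"
proof -
  interpret M: dg_module A M by fact
  interpret N: dg_module A N by fact
  have inj: "u = v" if "X \<in> obj A" "u \<in> mcar M X p" "v \<in> mcar M X p" "f X p u = f X p v" for X p u v
    using gf that by metis
  have "ext0 A M f \<in> mhom A M N 0"
    by (rule ext0_mhom) (simp_all add: f f_add f_scl f_act assms(1))
  moreover have "ext0 A N g \<in> mhom A N M 0"
  proof (rule ext0_mhom)
    fix X p x y assume "X \<in> obj A" "x \<in> mcar N X p" "y \<in> mcar N X p"
    then show "g X p (x + y) = g X p x + g X p y"
      by (intro inj[of X _ p]) (simp_all add: fg g f_add)
  next
    fix X p x c assume "X \<in> obj A" "x \<in> mcar N X p"
    then show "g X p (mscl N X p c x) = mscl M X (p + 0) c (g X p x)"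
      by (intro inj[of X _ p]) (simp_all add: fg g f_scl)
  next
    fix X Y p q x a assume "X \<in> obj A" "Y \<in> obj A" "x \<in> mcar N Y p" "a \<in> hom A X Y q"
    then show "g X (p + q) (mact N X Y p q x a) = mact M X Y (p + 0) q (g Y p x) a"
      by (intro inj[of X _ "p + q"]) (simp_all add: fg g f_act)
  qed (simp_all add: g assms(2))
  moreover have "mhom_dif A M N 0 (ext0 A M f) = 0"
    unfolding mhom_dif_def by (auto simp: fun_eq_iff ext0_def sg_def f_dif)
  moreover have "mhom_dif A N M 0 (ext0 A N g) = 0"
  proof -
    have "g X (p + 1) (mdif N X p y) = mdif M X p (g X p y)" if "X \<in> obj A" "y \<in> mcar N X p" for X p y
      using that by (intro inj[of X _ "p + 1"]) (simp_all add: fg g f_dif)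
    then show ?thesis
      unfolding mhom_dif_def by (auto simp: fun_eq_iff ext0_def sg_def)
  qed
  moreover have "mcomp A M 0 (ext0 A N g) (ext0 A M f)
    = mid A M" "mcomp A N 0 (ext0 A M f) (ext0 A N g) = mid A N"
    unfolding mcomp_def mid_def by (rule ext0_eqI, simp add: f g fg gf)+
  ultimately show ?thesis unfolding iso_pair_def by blast
qed

lemma mod_iso_refl: "dg_module A M \<Longrightarrow> mod_iso A M M"
  unfolding mod_iso_iff by (rule exI, rule exI, rule iso_pairI[where f="\<lambda>X p x. x"
    and g="\<lambda>X p x. x"]) auto

lemma mod_iso_sym: "mod_iso A M N \<Longrightarrow> mod_iso A N M"
  unfolding mod_iso_iff using iso_pair_sym by blast

lemma mod_iso_trans:
  assumes "dg_module A L" "dg_module A M" "dg_module A N" "mod_iso A L M" "mod_iso A M N"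
  shows "mod_iso A L N"
proof -
  obtain \<phi> \<phi>' \<psi> \<psi>' where iso: "iso_pair A L M \<phi> \<phi>'" "iso_pair A M N \<psi> \<psi>'"
    using assms(4,5) unfolding mod_iso_iff by blast
  interpret P: dg_morphism A L M 0 \<phi> using iso assms by (simp add: dg_morphism_iff iso_pair_def)
  interpret Q: dg_morphism A M N 0 \<psi> using iso assms by (simp add: dg_morphism_iff iso_pair_def)
  interpret P': dg_morphism A M L 0 \<phi>' using iso assms by (simp add: dg_morphism_iff iso_pair_def)
  interpret Q': dg_morphism A N M 0 \<psi>' using iso assms by (simp add: dg_morphism_iff iso_pair_def)
  note [simp] = iso_pairD[OF iso(1)] iso_pairD[OF iso(2)] iso_pairD[OF iso_pair_sym[OF iso(1)]]
    iso_pairD[OF iso_pair_sym[OF iso(2)]]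
  show ?thesis unfolding mod_iso_iff
    by (rule exI, rule exI, rule iso_pairI[where f="\<lambda>X p x. \<psi> X p (\<phi> X p x)"
      and g="\<lambda>X p x. \<phi>' X p (\<psi>' X p x)"])
      (simp_all add: assms)
qed

lemma closed_mcomp:
  assumes "dg_module A L" "dg_module A M" "dg_module A N" "\<phi> \<in> mhom A L M 0" "\<psi> \<in> mhom A M N 0"
    and "mhom_dif A L M 0 \<phi> = 0" "mhom_dif A M N 0 \<psi> = 0"
  shows "mhom_dif A L N 0 (mcomp A L 0 \<psi> \<phi>) = 0"
proof -
  interpret P: dg_morphism A L M 0 \<phi> using assms by (simp add: dg_morphism_iff)
  interpret Q: dg_morphism A M N 0 \<psi> using assms by (simp add: dg_morphism_iff)
  show ?thesis
    unfolding mhom_dif_def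
    by (auto simp: fun_eq_iff ext0_def sg_def mcomp_def closed_morphism_dif[OF assms(6)] closed_morphism_dif[OF assms(7)])
qed

text \<open>Conjugating \<phi> by the given isomorphisms yields \<phi>', for which the pair of
  isomorphisms acts componentwise on the cones. This allows the terms of a cone to be replaced by
  generators of the hull.\<close>

lemma mod_iso_cone:
  assumes "dg_module A M" "dg_module A N" "dg_module A M'" "dg_module A N'"
    and "\<phi> \<in> mhom A M N 0" "mhom_dif A M N 0 \<phi> = 0"
    and "mod_iso A M M'" "mod_iso A N N'"
  obtains \<phi>' where "\<phi>' \<in> mhom A M' N' 0" "mhom_dif A M' N' 0 \<phi>'
    = 0" "mod_iso A (cone M N \<phi>) (cone M' N' \<phi>')"
proof -
  obtain \<alpha> \<alpha>' \<beta> \<beta>' where iso: "iso_pair A M M' \<alpha> \<alpha>'" "iso_pair A N N' \<beta> \<beta>'"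
    using assms(7,8) unfolding mod_iso_iff by blast
  interpret P: dg_morphism A M N 0 \<phi> using assms by (simp add: dg_morphism_iff)
  interpret a: dg_morphism A M M' 0 \<alpha> using iso assms by (simp add: dg_morphism_iff iso_pair_def)
  interpret b: dg_morphism A N N' 0 \<beta> using iso assms by (simp add: dg_morphism_iff iso_pair_def)
  interpret a': dg_morphism A M' M 0 \<alpha>' using iso assms by (simp add: dg_morphism_iff iso_pair_def)
  interpret b': dg_morphism A N' N 0 \<beta>' using iso assms by (simp add: dg_morphism_iff iso_pair_def)
  note [simp] = iso_pairD[OF iso(1)] iso_pairD[OF iso(2)] iso_pairD[OF iso_pair_sym[OF iso(1)]]
    iso_pairD[OF iso_pair_sym[OF iso(2)]]
  let ?\<phi> = "mcomp A M' 0 \<beta> (mcomp A M' 0 \<phi> \<alpha>')"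
  have "mcomp A M' 0 \<phi> \<alpha>' \<in> mhom A M' N 0" "mhom_dif A M' N 0 (mcomp A M' 0 \<phi> \<alpha>') = 0"
    using iso assms mcomp_mhom[of A M' M N \<alpha>' 0 \<phi> 0] closed_mcomp[of A M' M N \<alpha>' \<phi>] by
      (simp_all add: iso_pair_def)
  then have 1: "?\<phi> \<in> mhom A M' N' 0" "mhom_dif A M' N' 0 ?\<phi> = 0"
    using iso assms mcomp_mhom[of A M' N N' _ 0 \<beta> 0] closed_mcomp[of A M' N N' _ \<beta>] by
      (simp_all add: iso_pair_def)
  define \<phi>' where "\<phi>' = ?\<phi>"
  have \<phi>': "\<phi>' X p x = \<beta> X p (\<phi> X p (\<alpha>' X p x))" if "X \<in> obj A" "x \<in> mcar M' X p" for X p x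
    using that by (simp add: \<phi>'_def mcomp_def)
  have c: "dg_module A (cone M' N' \<phi>')" "dg_module A (cone M N \<phi>)"
    using dg_module_cone assms 1 unfolding \<phi>'_def by blast+
  have "mod_iso A (cone M N \<phi>) (cone M' N' \<phi>')"
    unfolding mod_iso_iff
    by (rule exI, rule exI, rule iso_pairI[where f="\<lambda>X p (x, y). (\<alpha> X (p + 1) x, \<beta> X p y)"
          and g="\<lambda>X p (x, y). (\<alpha>' X (p + 1) x, \<beta>' X p y)"])
      (auto simp: c \<phi>' ac_simps)
  with 1 show ?thesis using that unfolding \<phi>'_def by blast
qed

section \<open>Change of the type of elements\<close>

locale embedding =
  fixes e :: "'v::ab_group_add \<Rightarrow> 'u::ab_group_add"
  assumes inj: "inj e" and add: "e (x + y) = e x + e y"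
begin

lemma inv_e [simp]: "inv e (e x) = x"
  using inj by simp

lemma eq_iff [simp]: "e x = e y \<longleftrightarrow> x = y"
  using inj by (simp add: inj_eq)

lemma e_zero [simp]: "e 0 = 0"
  using add[of 0 0] by simp

lemma e_minus: "e (- x) = - e x"
  using add[of x "- x"] by (simp add: eq_neg_iff_add_eq_0 add.commute)

lemma e_diff: "e (x - y) = e x - e y"
  using add[of x "- y"] by (simp add: e_minus)

lemma add_rev: "e x + e y = e (x + y)" "- e x = e (- x)" "e x - e y = e (x - y)" "sg n (e x)
  = e (sg n x)"
  by (simp_all add: add sg_def e_minus e_diff)

lemma copy_sel [simp]:
  "mcar (copy e M) X p = e ` mcar M X p" "mscl (copy e M) X p c (e x) = e (mscl M X p c x)"
  "mdif (copy e M) X p (e x) = e (mdif M X p x)" "mact (copy e M) X Y p q (e x) a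
    = e (mact M X Y p q x a)"
  by (simp_all add: copy_def)

lemma dg_module_copy:
  assumes "dg_module A M"
  shows "dg_module A (copy e M)"
proof -
  interpret dg_module A M by fact
  show ?thesis
  proof (unfold_locales, goal_cases)
    case (1 X p)
    have "kmodule (mcar M X p) (mscl M X p)" using 1 mcar_kmodule by blast
    note k = kmoduleD[OF this]
    show ?case
      unfolding kmodule_def using k by (auto simp: add_rev image_iff intro!: bexI[of _ 0])
  next
    case (5 X x p)
    then show ?case by auto
  next
    case (13 X Y x p a q)
    then show ?case by (auto simp: mdif_mact' add_rev)
  qed (auto simp: add_rev mact_cmp' )
qed

end

text \<open>\<open>Copy\<close> on morphisms, but with separate embeddings for source and target:
  the natural isomorphism runs between modules copied along different maps.\<close>

definition copy_mor ::
  "('v \<Rightarrow> 'u) \<Rightarrow> ('w \<Rightarrow> 'u'::zero) \<Rightarrow> ('o \<Rightarrow> int \<Rightarrow> 'v \<Rightarrow> 'w) \<Rightarrow> 'o \<Rightarrow> int \<Rightarrow> 'u \<Rightarrow> 'u'" where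
  "copy_mor e e' \<phi> = (\<lambda>X p u. if u \<in> range e then e' (\<phi> X p (inv e u)) else 0)"

lemma Copy_sel [simp]: "fob (Copy e) = copy e" "fmor (Copy e) M N n = copy_mor e e"
  by (simp_all add: Copy_def copy_mor_def fun_eq_iff)

locale embeddings = e: embedding e + e': embedding e'
  for e :: "'v::ab_group_add \<Rightarrow> 'u::ab_group_add" and e' :: "'v'::ab_group_add \<Rightarrow> 'u'::ab_group_add"
begin

lemma copy_mor_apply [simp]: "copy_mor e e' \<phi> X p (e x) = e' (\<phi> X p x)"
  by (simp add: copy_mor_def)

lemma copy_mor_ext0: "copy_mor e e' (ext0 A M \<phi>) = ext0 A (copy e M) (copy_mor e e' \<phi>)"
  by (auto simp: copy_mor_def ext0_def fun_eq_iff)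

lemma copy_mor_mhom:
  assumes "dg_module A M" "dg_module A N" "\<phi> \<in> mhom A M N n"
  shows "copy_mor e e' \<phi> \<in> mhom A (copy e M) (copy e' N) n"
proof -
  interpret P: dg_morphism A M N n \<phi> using assms by (simp add: dg_morphism_iff)
  have "ext0 A (copy e M) (copy_mor e e' \<phi>) \<in> mhom A (copy e M) (copy e' N) n"
    by (rule ext0_mhom) (auto simp: e.add_rev e'.add_rev e.dg_module_copy assms)
  then show ?thesis by (simp flip: copy_mor_ext0)
qed

lemma copy_mor_dif: "mhom_dif A (copy e M) (copy e' N) n (copy_mor e e' \<phi>)
  = copy_mor e e' (mhom_dif A M N n \<phi>)"
  unfolding mhom_dif_def copy_mor_ext0 by (rule ext0_eqI) (auto simp: sg_def e'.add e'.e_diff)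

lemma copy_mor_arith: "copy_mor e e' (\<phi> + \<psi>) = copy_mor e e' \<phi> + copy_mor e e' \<psi>" "copy_mor e e' 0 = 0"
  by (auto simp: copy_mor_def fun_eq_iff e'.add)

lemma copy_mor_scl: "copy_mor e e' (mhom_scl A M N n c \<phi>)
  = mhom_scl A (copy e M) (copy e' N) n c (copy_mor e e' \<phi>)"
  unfolding mhom_scl_def copy_mor_ext0 by (rule ext0_eqI) auto

end

lemma copy_mor_mcomp:
  assumes "embedding e" "embedding e'" "embedding e''"
  shows "mcomp A (copy e L) n (copy_mor e' e'' \<psi>) (copy_mor e e' \<phi>) = copy_mor e e'' (mcomp A L n \<psi> \<phi>)"
proof -
  interpret embeddings e e' using assms by (simp add: embeddings_def)
  interpret f: embeddings e' e'' using assms by (simp add: embeddings_def)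
  interpret g: embeddings e e'' using assms by (simp add: embeddings_def)
  show ?thesis unfolding mcomp_def g.copy_mor_ext0 by (rule ext0_eqI) auto
qed

lemma copy_mor_mid:
  assumes "embedding e"
  shows "copy_mor e e (mid A M) = mid A (copy e M)"
proof -
  interpret embeddings e e using assms by (simp add: embeddings_def)
  show ?thesis unfolding mid_def copy_mor_ext0 by (rule ext0_eqI) auto
qed

lemma iso_pair_copy:
  assumes "embedding e" "embedding e'" "dg_module A M" "dg_module A N" "iso_pair A M N \<phi> \<psi>"
  shows "iso_pair A (copy e M) (copy e' N) (copy_mor e e' \<phi>) (copy_mor e' e \<psi>)"
proof -
  interpret a: embeddings e e' using assms by (simp add: embeddings_def)
  interpret b: embeddings e' e using assms by (simp add: embeddings_def)
  show ?thesis
    using assms unfolding iso_pair_def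
    by (simp add: a.copy_mor_mhom b.copy_mor_mhom a.copy_mor_dif b.copy_mor_dif a.copy_mor_arith b.copy_mor_arith copy_mor_mcomp copy_mor_mid)
qed

lemma embedding_id: "embedding id"
  by unfold_locales auto

lemma copy_id: "copy id (M :: ('k, 'o, 'm, 'v) dgmod) = M"
  by (cases M) (simp add: copy_def)

text \<open>A self-isomorphism of \<open>M\<close> is copied along \<open>id\<close> on the source
  and \<open>e\<close> on the target; \<open>copy id M\<close> is \<open>M\<close> itself.\<close>

lemma mod_iso_copy:
  assumes "embedding e" "dg_module A M"
  shows "mod_iso A M (copy e M)"
proof -
  obtain \<phi> \<psi> where "iso_pair A M M \<phi> \<psi>" using mod_iso_refl[OF assms(2)] unfolding mod_iso_iff by blast
  from iso_pair_copy[OF embedding_id assms(1) assms(2,2) this] show ?thesis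
    unfolding mod_iso_iff copy_id by blast
qed

section \<open>Closure properties of the pretriangulated hull\<close>

lemma pretr_sel [simp]:
  "hom (pretr A) = mhom A" "scl (pretr A) = mhom_scl A" "dif (pretr A) = mhom_dif A"
  "cmp (pretr A) L M N m n = mcomp A L n" "idn (pretr A) = mid A"
  by (simp_all add: pretr_def Cdg_def)

lemma Cdg_sel [simp]:
  "obj (Cdg A) = {M. dg_module A M}"
  "hom (Cdg A) = mhom A" "scl (Cdg A) = mhom_scl A" "dif (Cdg A) = mhom_dif A"
  "cmp (Cdg A) L M N m n = mcomp A L n" "idn (Cdg A) = mid A"
  by (simp_all add: Cdg_def)

lemma pretr_gen_dg_module: "G \<in> pretr_gen A \<Longrightarrow> dg_module A G"
  by (induction rule: pretr_gen.induct) auto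

lemma obj_pretr: "M \<in> obj (pretr A) \<longleftrightarrow> dg_module A M \<and> (\<exists>G\<in>pretr_gen A. mod_iso A G M)"
  by (simp add: pretr_def)

lemma pretr_mod_iso:
  "\<lbrakk>M \<in> obj (pretr A); dg_module A N; mod_iso A M N\<rbrakk> \<Longrightarrow> N \<in> obj (pretr A)"
  unfolding obj_pretr using mod_iso_trans pretr_gen_dg_module by metis

lemma pretr_copy: "\<lbrakk>embedding e; M \<in> obj (pretr A)\<rbrakk> \<Longrightarrow> copy e M \<in> obj (pretr A)"
  using pretr_mod_iso mod_iso_copy embedding.dg_module_copy obj_pretr by metis

lemma pretr_rep:
  fixes A :: "('k::comm_ring_1, 'o, 'm::ab_group_add) dgcat"
  assumes "dg_category A" "Y \<in> obj A"
  shows "rep A Y \<in> obj (pretr A)"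
proof -
  interpret dg_category A by fact
  \<comment> \<open>\<open>pretr_gen\<close> consists of modules whose elements are sequences, so an
    element of \<open>A(X,Y)\<close> is stored as a sequence supported at index 0.\<close>
  define e :: "'m \<Rightarrow> nat \<Rightarrow> 'm" where "e = (\<lambda>x n. if n = 0 then x else 0)"
  have e: "embedding e"
    by unfold_locales (auto simp: e_def inj_def fun_eq_iff split: if_splits)
  have r: "dg_module A (rep A Y)"
    using assms by simp
  have m: "mod_iso A (rep A Y) (copy e (rep A Y))" and d: "dg_module A (copy e (rep A Y))"
    using mod_iso_copy[OF e r] embedding.dg_module_copy[OF e r] by blast+
  then have "copy e (rep A Y) \<in> pretr_gen A" using pretr_gen.gen_rep assms by metis
  then show ?thesis unfolding obj_pretr using m assms mod_iso_sym by auto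
qed

lemma pretr_cone:
  fixes A :: "('k::comm_ring_1, 'o, 'm::ab_group_add) dgcat"
  assumes "M \<in> obj (pretr A)" "N \<in> obj (pretr A)" "\<phi> \<in> mhom A M N 0" "mhom_dif A M N 0 \<phi> = 0"
  shows "cone M N \<phi> \<in> obj (pretr A)"
proof -
  obtain G H where G: "G \<in> pretr_gen A" "mod_iso A M G" and H: "H \<in> pretr_gen A" "mod_iso A N H"
    and MN: "dg_module A M" "dg_module A N"
    using assms(1,2) mod_iso_sym unfolding obj_pretr by metis
  have GH: "dg_module A G" "dg_module A H" using G H pretr_gen_dg_module by auto
  obtain \<phi>' where p: "\<phi>' \<in> mhom A G H 0" "mhom_dif A G H 0 \<phi>' = 0"
    and iso: "mod_iso A (cone M N \<phi>) (cone G H \<phi>')"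
    using mod_iso_cone[OF MN GH assms(3,4) G(2) H(2)] by metis
  \<comment> \<open>Elements of a cone are pairs of sequences; interleaving them at even and odd
    indices gives one sequence, the element type of \<open>pretr_gen\<close>.\<close>
  define e :: "(nat \<Rightarrow> 'm) \<times> (nat \<Rightarrow> 'm) \<Rightarrow> nat \<Rightarrow> 'm" where
    "e = (\<lambda>(a, b) i. if even i then a (i div 2) else b (i div 2))"
  have e: "embedding e"
  proof
    show "inj e"
    proof (rule injI, clarify)
      fix a b a' b' assume eq: "e (a, b) = e (a', b')"
      have "a i = a' i \<and> b i = b' i" for i
        using fun_cong[OF eq, of "2 * i"] fun_cong[OF eq, of "2 * i + 1"] by (simp add: e_def)
      then show "a = a' \<and> b = b'" by auto
    qed
  qed (auto simp: e_def fun_eq_iff)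
  have c: "dg_module A (cone G H \<phi>')" using GH p dg_module_cone by blast
  then have m: "mod_iso A (cone G H \<phi>') (copy e (cone G H \<phi>'))"
    and d: "dg_module A (copy e (cone G H \<phi>'))"
    using mod_iso_copy e embedding.dg_module_copy by auto
  have "copy e (cone G H \<phi>') \<in> pretr_gen A"
    using pretr_gen.gen_cone[OF G(1) H(1) _ d m] p by (simp add: closed0_def)
  moreover have "mod_iso A (cone M N \<phi>) (copy e (cone G H \<phi>'))"
    using mod_iso_trans[OF _ c d iso m] dg_module_cone MN assms by blast
  ultimately show ?thesis
    unfolding obj_pretr using dg_module_cone[OF MN assms(3,4)] mod_iso_sym by blast
qed

section \<open>Dg functors\<close>

lemma dg_functor_fcomp:
  assumes "dg_functor C D F" "dg_functor D E G"
  shows "dg_functor C E (G \<circ>\<^sub>F F)"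
  using assms unfolding dg_functor_def fcomp_def by auto


text \<open>Composition in the opposite category carries a sign, so \<open>F\<close> must commute
  with negating a composite. In \<open>dg_functor\<close> additivity is stated only for arguments
  lying in a Hom group, hence the second premise.\<close>

lemma dg_functor_opp:
  assumes "dg_functor C D F"
    and "\<And>X Y Z m n g f. \<lbrakk>X \<in> obj C; Y \<in> obj C; Z \<in> obj C; g \<in> hom C Y Z m; f \<in> hom C X Y n\<rbrakk>
      \<Longrightarrow> fmor F X Z (m + n) (- cmp C X Y Z m n g f) = - fmor F X Z (m + n) (cmp C X Y Z m n g f)"
  shows "dg_functor (opp C) (opp D) (opp_fun F)"
proof -
  \<comment> \<open>The degree \<open>k\<close> is free because reversing a composite turns the
    expected \<open>n + m\<close> into \<open>m + n\<close>.\<close>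
  have "fmor F X Z k (cmp C X Y Z m n g f)
      = cmp D (fob F X) (fob F Y) (fob F Z) m n (fmor F Y Z m g) (fmor F X Y n f)"
    "fmor F X Z k (- cmp C X Y Z m n g f)
      = - cmp D (fob F X) (fob F Y) (fob F Z) m n (fmor F Y Z m g) (fmor F X Y n f)"
    if "X \<in> obj C" "Y \<in> obj C" "Z \<in> obj C" "g \<in> hom C Y Z m" "f \<in> hom C X Y n" "k = m + n"
      for X Y Z m n k g f
    using assms that unfolding dg_functor_def by simp_all
  note cmp = this
  show ?thesis
    unfolding dg_functor_def opp_fun_def opp_sel dgfun.simps
  proof (intro conjI, goal_cases)
    case 3
    show ?case
    proof (intro ballI allI)
      fix X Y Z m n g f
      assume "X \<in> obj C" "Y \<in> obj C" "Z \<in> obj C" "g \<in> hom C Z Y m" "f \<in> hom C Y X n"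
      then show "fmor F Z X (m + n) (sg (m * n) (cmp C Z Y X n m f g))
        = sg (m * n) (cmp D (fob F Z) (fob F Y) (fob F X) n m (fmor F Y X n f) (fmor F Z Y m g))"
        using cmp[of Z Y X f n g m "m + n"] by (simp add: sg_def)
    qed
  qed (use assms(1) in \<open>simp_all add: dg_functor_def\<close>)
qed

lemma opp_fun_sel [simp]: "fob (opp_fun F) = fob F" "fmor (opp_fun F) X Y = fmor F Y X"
  by (simp_all add: opp_fun_def)

lemma fcomp_sel [simp]:
  "fob (G \<circ>\<^sub>F F) X = fob G (fob F X)" "fmor (G \<circ>\<^sub>F F) X Y n f
    = fmor G (fob F X) (fob F Y) n (fmor F X Y n f)"
  by (simp_all add: fcomp_def)

text \<open>The hull is a full dg subcategory, so only the values on objects are in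
  question.\<close>

lemma dg_functor_pretr:
  assumes "dg_functor C (Cdg A) F" "\<And>X. X \<in> obj C \<Longrightarrow> fob F X \<in> obj (pretr A)"
  shows "dg_functor C (pretr A) F"
  using assms unfolding dg_functor_def by simp

lemma dg_functor_Copy:
  assumes "embedding e"
  shows "dg_functor (Cdg A) (Cdg A) (Copy e)"
proof -
  interpret embeddings e e using assms by (simp add: embeddings_def)
  show ?thesis
    unfolding dg_functor_def using assms
    by (auto simp: e.dg_module_copy copy_mor_mhom copy_mor_arith copy_mor_scl copy_mor_dif
      copy_mor_mcomp copy_mor_mid)
qed

lemma ext0_apply: "ext0 A M \<phi> X p x = (if X \<in> obj A \<and> x \<in> mcar M X p then \<phi> X p x else 0)"
  by (simp add: ext0_def)

lemma Shift_sel [simp]: "fob (Shift k) M = shift k M" "fmor (Shift k) M N n \<phi>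
  = (\<lambda>X p x. sg (k * n) (\<phi> X (p + k) x))"
  by (simp_all add: Shift_def)

lemma shift_mhom:
  assumes "dg_module A M" "dg_module A N" "\<phi> \<in> mhom A M N n"
  shows "fmor (Shift k) M N n \<phi> \<in> mhom A (shift k M) (shift k N) n"
proof -
  interpret P: dg_morphism A M N n \<phi> using assms by (simp add: dg_morphism_iff)
  have "ext0 A (shift k M) (fmor (Shift k) M N n \<phi>) \<in> mhom A (shift k M) (shift k N) n"
    by (rule ext0_mhom) (simp_all add: P.M.dg_module_shift ac_simps sg_def)
  moreover have "ext0 A (shift k M) (fmor (Shift k) M N n \<phi>) = fmor (Shift k) M N n \<phi>"
    by (auto simp: fun_eq_iff ext0_apply P.out sg_def)
  ultimately show ?thesis by simp
qed

text \<open>The sign \<open>(-1)^(k n)\<close> on a degree \<open>n\<close> morphism absorbs the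
  factor \<open>(-1)^k\<close> that both differentials acquire when the degree rises from
  \<open>n\<close> to \<open>n + 1\<close>.\<close>

lemma dg_functor_Shift: "dg_functor (Cdg A) (Cdg A) (Shift k)"
  unfolding dg_functor_def
proof (intro conjI ballI allI, goal_cases)
  case (1 M)
  then show ?case by (simp add: dg_module.dg_module_shift)
next
  case (2 M N n \<phi>)
  then show ?case by (simp add: shift_mhom del: Shift_sel(2))
next
  case (3 M N n \<phi> \<psi>)
  then show ?case by (auto simp: sg_def fun_eq_iff)
next
  case (4 M N n \<phi> c)
  interpret P: dg_morphism A M N n \<phi> using 4 by (simp add: dg_morphism_iff)
  show ?case by (auto simp: sg_def fun_eq_iff mhom_scl_def ext0_apply ac_simps)
next
  case (5 M N n \<phi>)
  interpret P: dg_morphism A M N n \<phi> using 5 by (simp add: dg_morphism_iff)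
  show ?case
    by (cases "even n"; cases "even k"; auto simp: sg_def fun_eq_iff mhom_dif_def ext0_apply ac_simps)
next
  case (6 L M N m n \<psi> \<phi>)
  interpret P: dg_morphism A L M n \<phi> using 6 by (simp add: dg_morphism_iff)
  interpret Q: dg_morphism A M N m \<psi> using 6 by (simp add: dg_morphism_iff)
  show ?case
    by (cases "even n"; cases "even k"; cases "even m"; auto simp: sg_def fun_eq_iff mcomp_def ext0_apply ac_simps)
next
  case (7 M)
  then show ?case by (auto simp: sg_def fun_eq_iff mid_def ext0_apply)
qed

section \<open>Three-term complexes\<close>

lemma Cpx3_sel [simp]:
  "obj (Cpx3 A) = cpx_obj A" "hom (Cpx3 A) = cpx_hom A" "scl (Cpx3 A) = cpx_scl A"
  "dif (Cpx3 A) = cpx_dif A" "cmp (Cpx3 A) = cpx_cmp A" "idn (Cpx3 A) = cpx_idn A"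
  by (simp_all add: Cpx3_def)

lemma Cx_mem [simp]: "Cx X Y Z f g h \<in> cpx_obj A \<longleftrightarrow>
   X \<in> obj A \<and> Y \<in> obj A \<and> Z \<in> obj A \<and> f \<in> hom A X Y 0 \<and> dif A X Y 0 f = 0 \<and>
   g \<in> hom A Y Z 0 \<and> dif A Y Z 0 g = 0 \<and> h \<in> hom A X Z (- 1) \<and> dif A X Z (- 1) h =
     - cmp A X Y Z 0 0 g f"
  by (auto simp: cpx_obj_def closed0_def)

lemma Op3_sel [simp]:
  "fob Op3 = op_cpx" "fmor Op3 \<xi> \<xi>' n (r0, r1, r2, s1, s2, t) = (r2, r1, r0, - s2, - s1, - t)"
  by (simp_all add: Op3_def)

lemma op_cpx_mem [simp]: "\<xi> \<in> cpx_obj A \<Longrightarrow> op_cpx \<xi> \<in> cpx_obj (opp A)"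
  by (cases \<xi>) (auto simp: sg_def)

lemma sg_Pair: "sg n (a, b) = (sg n a, sg n b)"
  by (simp add: sg_def)

text \<open>Reversal exchanges the terms \<open>f' r0\<close> and \<open>r1 f\<close> (likewise
  \<open>g' r1\<close> and \<open>r2 g\<close>), which occur with opposite signs in the
  differential; hence the minus on \<open>s1\<close> and \<open>s2\<close>. The terms with
  \<open>h\<close> have opposite signs up to a Koszul sign \<open>(-1)^n\<close>, which forces the
  minus on \<open>t\<close> as well.\<close>

lemma dg_functor_Op3:
  assumes "dg_category A"
  shows "dg_functor (opp (Cpx3 A)) (Cpx3 (opp A)) Op3"
proof -
  interpret dg_category A by fact
  show ?thesis
    unfolding dg_functor_def
  proof (intro conjI ballI allI, goal_cases)
    case (1 \<xi>)
    then show ?case by simp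
  next
    case (2 \<xi>' \<xi> n \<Xi>)
    then show ?case by (cases \<xi>; cases \<xi>'; cases \<Xi>) auto
  next
    case (3 \<xi>' \<xi> n \<Xi> \<Theta>)
    then show ?case by (cases \<Xi>; cases \<Theta>) auto
  next
    case (4 \<xi>' \<xi> n \<Xi> c)
    then show ?case by (cases \<xi>; cases \<xi>'; cases \<Xi>) auto
  next
    case (5 \<xi>' \<xi> n \<Xi>)
    then show ?case
      by (cases \<xi>; cases \<xi>'; cases \<Xi>; cases "even n") (auto simp: sg_def)
  next
    case (6 \<xi>'' \<xi>' \<xi> m n \<Xi> \<Theta>)
    then show ?case
      by (cases \<xi>; cases \<xi>'; cases \<xi>''; cases \<Xi>; cases \<Theta>; cases "even n"; cases "even m")
        (auto simp: sg_def sg_Pair)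
  next
    case (7 \<xi>)
    then show ?case by (cases \<xi>) simp
  qed
qed

section \<open>Totalization\<close>

lemmas [simp del] = tot.simps

text \<open>The nested cones flattened to triples. The minus signs of the two cone differentials
  cancel on the first coordinate, and the outer one negates the whole second coordinate, including
  the entry \<open>f\<close>.\<close>

lemma tot_sel [simp]:
  "mcar (tot A (Cx X Y Z f g h)) V p = (hom A V X (p + 2) \<times> hom A V Y (p + 1)) \<times> hom A V Z p"
  "mscl (tot A (Cx X Y Z f g h)) V p c ((x, y), z)
    = ((scl A V X (p + 2) c x, scl A V Y (p + 1) c y), scl A V Z p c z)"
  "mact (tot A (Cx X Y Z f g h)) V W p q ((x, y), z) a
    = ((cmp A V W X (p + 2) q x a, cmp A V W Y (p + 1) q y a), cmp A V W Z p q z a)"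
  "\<lbrakk>V \<in> obj A; x \<in> hom A V X (p + 2); y \<in> hom A V Y (p + 1)\<rbrakk>
    \<Longrightarrow> mdif (tot A (Cx X Y Z f g h)) V p ((x, y), z)
    = ((dif A V X (p + 2) x, - cmp A V X Y 0 (p + 2) f x - dif A V Y (p + 1) y),
       - cmp A V X Z (- 1) (p + 2) h x + cmp A V Y Z 0 (p + 1) g y + dif A V Z p z)"
  by (simp_all add: tot.simps Let_def add.assoc)

lemma tot_pretr:
  assumes "dg_category A" "\<xi> \<in> cpx_obj A"
  shows "tot A \<xi> \<in> obj (pretr A)"
proof -
  interpret dg_category A by fact
  obtain X Y Z f g h where \<xi>: "\<xi> = Cx X Y Z f g h" by (cases \<xi>)
  note * = assms(2)[unfolded \<xi> Cx_mem]
  define K where "K = cone (rep A X) (rep A Y) (rep_mor A X Y 0 f)"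
  have K: "K \<in> obj (pretr A)"
    unfolding K_def
  proof (rule pretr_cone)
    show "mhom_dif A (rep A X) (rep A Y) 0 (rep_mor A X Y 0 f) = 0"
      using * by (auto simp: mhom_dif_def fun_eq_iff ext0_apply sg_def dif_cmp')
  qed (use assms * in \<open>simp_all add: pretr_rep rep_mor_mhom\<close>)
  define \<phi> where "\<phi> = ext0 A K (\<lambda>V p (x, y). - rep_mor A X Z (-1) h V (p + 1) x + rep_mor A Y Z 0 g V p y)"
  have "cone K (rep A Z) \<phi> \<in> obj (pretr A)"
  proof (rule pretr_cone)
    show "\<phi> \<in> mhom A K (rep A Z) 0"
      unfolding \<phi>_def
      by (rule ext0_mhom) (use * K in \<open>auto simp: K_def obj_pretr assoc algebra_simps\<close>)
    \<comment> \<open>Comparing \<open>d \<phi>\<close> with \<phi> applied to the differential of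
      \<open>K\<close> leaves \<open>- dif h\<close> against \<open>g f\<close>: closedness is the
      defining equation of a 3-term complex.\<close>
    show "mhom_dif A K (rep A Z) 0 \<phi> = 0"
      using * by (auto simp: \<phi>_def K_def mhom_dif_def fun_eq_iff ext0_apply sg_def dif_cmp' assoc algebra_simps)
  qed (use assms * K in \<open>simp_all add: pretr_rep\<close>)
  then show ?thesis by (simp add: \<xi> tot.simps Let_def K_def \<phi>_def)
qed

lemma dg_module_tot [simp]: "\<lbrakk>dg_category A; \<xi> \<in> cpx_obj A\<rbrakk> \<Longrightarrow> dg_module A (tot A \<xi>)"
  using tot_pretr obj_pretr by blast

lemma Tot_sel [simp]: "fob (Tot A) = tot A" "fmor (Tot A) = tot_mor A"
  by (simp_all add: Tot_def)

lemma tot_mor_mhom: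
  assumes "dg_category A" "\<xi> \<in> cpx_obj A" "\<xi>' \<in> cpx_obj A" "\<Xi> \<in> cpx_hom A \<xi> \<xi>' n"
  shows "tot_mor A \<xi> \<xi>' n \<Xi> \<in> mhom A (tot A \<xi>) (tot A \<xi>') n"
proof -
  interpret dg_category A by fact
  obtain X Y Z f g h where \<xi>: "\<xi> = Cx X Y Z f g h" by (cases \<xi>)
  obtain X' Y' Z' f' g' h' where \<xi>': "\<xi>' = Cx X' Y' Z' f' g' h'" by (cases \<xi>')
  obtain r0 r1 r2 s1 s2 t where \<Xi>: "\<Xi> = (r0, r1, r2, s1, s2, t)" by (cases \<Xi>)
  note * = assms(2-4)[unfolded \<xi> \<xi>' \<Xi> Cx_mem, simplified]
  show ?thesis
    unfolding \<xi> \<xi>' \<Xi> tot_mor.simps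
    by (rule ext0_mhom, goal_cases)
      (use * assms(1) in \<open>cases "even n"; auto simp: assoc algebra_simps sg_def\<close>)+
qed

text \<open>Differential and composition of sextuples are what one reads off from the graded
  commutator with the differentials and from the product of lower triangular matrices.\<close>

lemma dg_functor_Tot:
  assumes "dg_category A"
  shows "dg_functor (Cpx3 A) (Cdg A) (Tot A)"
proof -
  interpret dg_category A by fact
  show ?thesis
    unfolding dg_functor_def
  proof (intro conjI ballI allI, goal_cases)
    case (1 \<xi>)
    then show ?case using assms by simp
  next
    case (2 \<xi> \<xi>' n \<Xi>)
    then show ?case using assms by (simp add: tot_mor_mhom)
  next
    case (3 \<xi> \<xi>' n \<Xi> \<Theta>)
    then show ?case
      by (cases \<xi>; cases \<xi>'; cases \<Xi>; cases \<Theta>)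
        (auto simp: sg_def algebra_simps simp flip: ext0_arith intro!: ext0_eqI)
  next
    case (4 \<xi> \<xi>' n \<Xi> c)
    then show ?case
      by (cases \<xi>; cases \<xi>'; cases \<Xi>)
        (auto simp: sg_def algebra_simps mhom_scl_def intro!: ext0_eqI)
  next
    case (5 \<xi> \<xi>' n \<Xi>)
    then show ?case
      by (cases \<xi>; cases \<xi>'; cases \<Xi>; cases "even n")
        (auto simp: sg_def algebra_simps mhom_dif_def assoc dif_cmp' intro!: ext0_eqI)
  next
    case (6 \<xi> \<xi>' \<xi>'' m n \<Xi> \<Theta>)
    then show ?case
      by (cases \<xi>; cases \<xi>'; cases \<xi>''; cases \<Xi>; cases \<Theta>; cases "even n"; cases "even m")
       (auto simp: sg_def algebra_simps mcomp_def assoc intro!: ext0_eqI)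
  next
    case (7 \<xi>)
    then show ?case by (cases \<xi>) (auto simp: mid_def sg_def intro!: ext0_eqI)
  qed
qed

section \<open>Duality\<close>

text \<open>An element of the dual. \<open>mem_rep\<close> states membership of its values in Hom
  groups, the form in which the rules for \<open>cmp\<close> and \<open>dif\<close> ask for
  it.\<close>

locale dg_functional = dg_morphism A M "rep A Y" n \<phi>
  for A :: "('k::comm_ring_1, 'o, 'm::ab_group_add) dgcat"
    and M :: "('k, 'o, 'm, 'v::ab_group_add) dgmod" and Y n \<phi>
begin

lemmas mem_rep [simp] = mem[simplified]

end

lemma dg_functional_iff:
  "dg_functional A M Y n \<phi> \<longleftrightarrow> dg_module A M \<and> dg_module A (rep A Y) \<and> \<phi> \<in> mhom A M (rep A Y) n"
  by (simp add: dg_functional_def dg_morphism_iff)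

lemma kmodule_scl_scl: "kmodule V s \<Longrightarrow> x \<in> V \<Longrightarrow> s c (s d x) = s d (s c x)"
  by (metis kmoduleD(7) mult.commute)

lemma kmodule_mhom:
  assumes "dg_module A M" "dg_module A N"
  shows "kmodule (mhom A M N n) (mhom_scl A M N n)"
  unfolding kmodule_def
proof (intro conjI ballI allI, goal_cases)
  case 1
  interpret N: dg_module A N by fact
  show ?case by (auto simp: mhom_def ext0_arith)
next
  case (2 \<phi> \<psi>)
  interpret P: dg_morphism A M N n \<phi> using 2 assms by (simp add: dg_morphism_iff)
  interpret Q: dg_morphism A M N n \<psi> using 2 assms by (simp add: dg_morphism_iff)
  have "ext0 A M (\<phi> + \<psi>) \<in> mhom A M N n"
    by (rule ext0_mhom) (simp_all add: assms ac_simps)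
  then show ?case by (simp add: ext0_arith)
next
  case (3 \<phi>)
  interpret P: dg_morphism A M N n \<phi> using 3 assms by (simp add: dg_morphism_iff)
  have "ext0 A M (- \<phi>) \<in> mhom A M N n"
    by (rule ext0_mhom) (simp_all add: assms)
  then show ?case by (simp add: ext0_arith)
next
  \<comment> \<open>That a scalar multiple is again linear rests on commutativity of the ground
    ring.\<close>
  case (4 c \<phi>)
  interpret P: dg_morphism A M N n \<phi> using 4 assms by (simp add: dg_morphism_iff)
  show ?case
    unfolding mhom_scl_def
    by (rule ext0_mhom) (simp_all add: assms kmodule_scl_scl[OF P.N.mcar_kmodule] ac_simps)
next
  case (5 c \<phi> \<psi>)
  interpret P: dg_morphism A M N n \<phi> using 5 assms by (simp add: dg_morphism_iff)
  interpret Q: dg_morphism A M N n \<psi> using 5 assms by (simp add: dg_morphism_iff)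
  show ?case by (auto simp: mhom_scl_def fun_eq_iff ext0_apply)
next
  case (6 c d \<phi>)
  interpret P: dg_morphism A M N n \<phi> using 6 assms by (simp add: dg_morphism_iff)
  show ?case by (auto simp: mhom_scl_def fun_eq_iff ext0_apply kmoduleD(6)[OF P.N.mcar_kmodule])
next
  case (7 c d \<phi>)
  interpret P: dg_morphism A M N n \<phi> using 7 assms by (simp add: dg_morphism_iff)
  show ?case by (auto simp: mhom_scl_def fun_eq_iff ext0_apply kmoduleD(7)[OF P.N.mcar_kmodule])
next
  case (8 \<phi>)
  interpret P: dg_morphism A M N n \<phi> using 8 assms by (simp add: dg_morphism_iff)
  show ?case by (auto simp: mhom_scl_def fun_eq_iff ext0_apply P.out kmoduleD(8)[OF P.N.mcar_kmodule])
qed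

lemma mhom_dif_dif:
  assumes "dg_module A M" "dg_module A N" "\<phi> \<in> mhom A M N n" "k = n + 1"
  shows "mhom_dif A M N k (mhom_dif A M N n \<phi>) = 0"
proof -
  interpret P: dg_morphism A M N n \<phi> using assms by (simp add: dg_morphism_iff)
  show ?thesis
    by (auto simp: mhom_dif_def fun_eq_iff ext0_apply sg_def assms(4) ac_simps)
qed

lemma dual_sel [simp]:
  "mcar (dual A M) Y p = mhom A M (rep A Y) p" "mscl (dual A M) Y p = mhom_scl A M (rep A Y) p"
  "mdif (dual A M) Y p = mhom_dif A M (rep A Y) p"
  "mact (dual A M) X Y p q \<phi> a = sg (p * q) (mcomp A M p (rep_mor A Y X q a) \<phi>)"
  by (simp_all add: dual_def)

text \<open>Postcomposition is a left action of \<open>A\<close>. The sign \<open>(-1)^(p q)\<close>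
  makes it a right action of the opposite category: acting twice and acting by an opposite composite
  both give \<open>(-1)^(p q + p r + q r)\<close>.\<close>

lemma dg_module_dual:
  assumes "dg_module A M"
  shows "dg_module (opp A) (dual A M)"
proof -
  interpret M: dg_module A M by fact
  interpret O: dg_category "opp A" using M.dg_category_axioms dg_category_opp by blast
  have m: "dg_functional A M Y p \<phi>" if "Y \<in> obj A" "\<phi> \<in> mhom A M (rep A Y) p" for Y p \<phi>
    using that assms by (simp add: dg_functional_iff)
  show ?thesis
  proof (unfold_locales, goal_cases)
    case (1 X p)
    then show ?case using kmodule_mhom[OF assms M.dg_module_rep] by simp
  next
    case (2 X x p)
    then show ?case by (simp add: mhom_dif_mhom assms)
  next
    case (3 X x p y)
    interpret P: dg_functional A M X p x using 3 m by simp
    interpret Q: dg_functional A M X p y using 3 m by simp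
    show ?case using 3 by (auto simp: mhom_dif_def fun_eq_iff ext0_apply sg_def)
  next
    case (4 X x p c)
    interpret P: dg_functional A M X p x using 4 m by simp
    show ?case using 4 by (auto simp: mhom_dif_def mhom_scl_def fun_eq_iff ext0_apply sg_def ac_simps)
  next
    case (5 X x p)
    then show ?case by (simp add: mhom_dif_dif[OF assms M.dg_module_rep])
  next
    case (6 X Y x p a q)
    then have "mcomp A M p (rep_mor A Y X q a) x \<in> mhom A M (rep A X) (p + q)"
      by (intro mcomp_mhom[of A M "rep A Y"]) (simp_all add: M.rep_mor_mhom assms)
    then show ?case using 6 kmodule_sg kmodule_mhom[OF assms]
      by (metis dual_sel(1,4) M.dg_module_rep opp_sel(1))
  next
    case (7 X Y x p y a q)
    interpret P: dg_functional A M Y p x using 7 m by simp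
    interpret Q: dg_functional A M Y p y using 7 m by simp
    show ?case using 7 by (auto simp: mcomp_def fun_eq_iff ext0_apply sg_def)
  next
    case (8 X Y x p a q b)
    interpret P: dg_functional A M Y p x using 8 m by simp
    show ?case using 8 by (auto simp: mcomp_def fun_eq_iff ext0_apply sg_def)
  next
    case (9 X Y x p a q c)
    interpret P: dg_functional A M Y p x using 9 m by simp
    show ?case using 9 by (auto simp: mcomp_def mhom_scl_def fun_eq_iff ext0_apply sg_def ac_simps)
  next
    case (10 X Y x p a q c)
    interpret P: dg_functional A M Y p x using 10 m by simp
    show ?case using 10 by (auto simp: mcomp_def mhom_scl_def fun_eq_iff ext0_apply sg_def ac_simps)
  next
    case (11 X Y Z x p a q b r)
    interpret P: dg_functional A M Z p x using 11 m by simp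
    show ?case using 11
      by (cases "even p"; cases "even q"; cases "even r";
        auto simp: mcomp_def fun_eq_iff ext0_apply sg_def M.assoc ac_simps)
  next
    case (12 X x p)
    interpret P: dg_functional A M X p x using 12 m by simp
    show ?case using 12 by (auto simp: mcomp_def fun_eq_iff ext0_apply sg_def P.out)
  next
    case (13 X Y x p a q)
    interpret P: dg_functional A M Y p x using 13 m by simp
    show ?case using 13
      by (cases "even p"; cases "even q";
        auto simp: mcomp_def mhom_dif_def fun_eq_iff ext0_apply sg_def M.dif_cmp' algebra_simps)
  qed
qed

section \<open>Duality on morphisms\<close>

lemma Dual_sel [simp]:
  "fob (Dual A) = dual A"
  "fmor (Dual A) N M n f = ext0 (opp A) (dual A N) (\<lambda>Y p \<phi>. sg (n * p) (mcomp A M n \<phi> f))"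
  by (simp_all add: Dual_def)

lemma dual_mor_mem:
  assumes "dg_module A M" "dg_module A N" "f \<in> mhom A M N n" "Y \<in> obj A" "\<phi>
    \<in> mhom A N (rep A Y) p" "k = p + n"
  shows "sg l (mcomp A M n \<phi> f) \<in> mhom A M (rep A Y) k"
proof -
  interpret M: dg_module A M by fact
  show ?thesis
    using assms by (intro kmodule_sg[OF kmodule_mhom] mcomp_mhom[of A M N]) auto
qed

lemma dg_functor_Dual:
  assumes "dg_category A"
  shows "dg_functor (opp (Cdg A)) (Cdg (opp A)) (Dual A)"
proof -
  interpret dg_category A by fact
  show ?thesis
    unfolding dg_functor_def
  proof (intro conjI ballI allI, goal_cases)
    case (1 M)
    then show ?case by (simp add: dg_module_dual)
  next
    case (2 N M n f)
    then interpret F: dg_morphism A M N n f by (simp add: dg_morphism_iff)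
    have "ext0 (opp A) (dual A N) (\<lambda>Y p \<phi>. sg (n * p) (mcomp A M n \<phi> f))
      \<in> mhom (opp A) (dual A N) (dual A M) n"
    proof (rule ext0_mhom, goal_cases)
      case (1 Y p \<phi>)
      then show ?case using dual_mor_mem[OF F.M.dg_module_axioms F.N.dg_module_axioms F.mhom, of Y \<phi> p] by simp
    next
      case (2 Y p \<phi> \<psi>)
      then interpret P: dg_functional A N Y p \<phi> by (simp add: dg_functional_iff F.N.dg_module_axioms)
      from 2 interpret Q: dg_functional A N Y p \<psi> by (simp add: dg_functional_iff F.N.dg_module_axioms)
      show ?case by (auto simp: mcomp_def fun_eq_iff ext0_apply sg_def)
    next
      case (3 Y p \<phi> c)
      then interpret P: dg_functional A N Y p \<phi> by (simp add: dg_functional_iff F.N.dg_module_axioms)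
      show ?case using 3 by (auto simp: mcomp_def mhom_scl_def fun_eq_iff ext0_apply sg_def ac_simps)
    next
      case (4 X Y p q \<phi> a)
      then interpret P: dg_functional A N Y p \<phi> by (simp add: dg_functional_iff F.N.dg_module_axioms)
      show ?case using 4
        by (cases "even p"; cases "even q"; cases "even n";
          auto simp: mcomp_def fun_eq_iff ext0_apply sg_def ac_simps)
    qed (simp add: dg_module_dual F.N.dg_module_axioms)
    then show ?case by simp
  next
    case (3 N M n f f')
    then interpret F: dg_morphism A M N n f by (simp add: dg_morphism_iff)
    from 3 interpret F': dg_morphism A M N n f' by (simp add: dg_morphism_iff)
    show ?case
      unfolding Dual_sel ext0_arith[symmetric]
    proof (rule ext0_eqI, goal_cases)
      case (1 Y p \<phi>)
      then interpret P: dg_functional A N Y p \<phi> by (simp add: dg_functional_iff F.N.dg_module_axioms)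
      show ?case by (auto simp: mcomp_def fun_eq_iff ext0_apply sg_def 1)
    qed
  next
    case (4 N M n f c)
    then interpret F: dg_morphism A M N n f by (simp add: dg_morphism_iff)
    show ?case
      unfolding Dual_sel Cdg_sel opp_sel mhom_scl_def[of "opp A"]
    proof (rule ext0_eqI, goal_cases)
      case (1 Y p \<phi>)
      then interpret P: dg_functional A N Y p \<phi> by (simp add: dg_functional_iff F.N.dg_module_axioms)
      show ?case using 1 by (auto simp: mcomp_def mhom_scl_def fun_eq_iff ext0_apply sg_def ac_simps)
    qed
  next
    case (5 N M n f)
    then interpret F: dg_morphism A M N n f by (simp add: dg_morphism_iff)
    show ?case
      unfolding Dual_sel Cdg_sel opp_sel mhom_dif_def[of "opp A"]
    proof (rule ext0_eqI, goal_cases)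
      case (1 Y p \<phi>)
      then interpret P: dg_functional A N Y p \<phi> by (simp add: dg_functional_iff F.N.dg_module_axioms)
      \<comment> \<open>The dual of \<open>f\<close> is cut off outside the carriers, so it can be
        evaluated at \<open>d \<phi>\<close> only after this membership is known.\<close>
      have d: "mhom_dif A N (rep A Y) p \<phi> \<in> mhom A N (rep A Y) (p + 1)"
        using mhom_dif_mhom[OF F.N.dg_module_axioms dg_module_rep P.mhom] 1 by simp
      show ?case using 1 d
        by (cases "even n"; cases "even p";
          auto simp: mcomp_def mhom_dif_def fun_eq_iff ext0_apply sg_def ac_simps)
    qed
  next
    case (6 N M L m n g f)
    then interpret F: dg_morphism A M N n f by (simp add: dg_morphism_iff)
    from 6 interpret G: dg_morphism A L M m g by (simp add: dg_morphism_iff)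
    show ?case
      unfolding Dual_sel Cdg_sel opp_sel mcomp_def[of "opp A"]
    proof (rule ext0_eqI, goal_cases)
      case (1 Y p \<phi>)
      then interpret P: dg_functional A N Y p \<phi> by (simp add: dg_functional_iff F.N.dg_module_axioms)
      have d: "sg (n * p) (mcomp A M n \<phi> f) \<in> mhom A M (rep A Y) (p + n)"
        using 1 dual_mor_mem[OF F.M.dg_module_axioms F.N.dg_module_axioms F.mhom, of Y \<phi> p] by simp
      show ?case using 1 d
        by (cases "even n"; cases "even p"; cases "even m";
          auto simp: mcomp_def fun_eq_iff ext0_apply sg_def ac_simps)
    qed
  next
    case (7 M)
    then interpret M: dg_module A M by simp
    show ?case
      unfolding Dual_sel Cdg_sel opp_sel mid_def[of "opp A"]
    proof (rule ext0_eqI, goal_cases)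
      case (1 Y p \<phi>)
      then interpret P: dg_functional A M Y p \<phi> by (simp add: dg_functional_iff M.dg_module_axioms)
      show ?case
        by (auto simp: mcomp_def mid_def fun_eq_iff ext0_apply sg_def P.out)
    qed
  qed
qed

section \<open>The duality isomorphism\<close>

lemma dg_functor_opp_Tot:
  assumes "dg_category A"
  shows "dg_functor (opp (Cpx3 A)) (opp (Cdg A)) (opp_fun (Tot A))"
proof (rule dg_functor_opp[OF dg_functor_Tot[OF assms]], goal_cases)
  case (1 \<xi> \<xi>' \<xi>'' m n \<Theta> \<Xi>)
  interpret dg_category A by fact
  show ?case using 1
    by (cases \<xi>; cases \<xi>'; cases \<xi>''; cases \<Xi>; cases \<Theta>; cases "even n"; cases "even m")
       (auto simp: sg_def algebra_simps simp flip: ext0_arith intro!: ext0_eqI)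
qed

lemma embedding_in1: "embedding (in1 :: 'v::ab_group_add \<Rightarrow> 'v \<times> 'w::ab_group_add)"
  by unfold_locales (auto simp: in1_def inj_def)

lemma embedding_in2: "embedding (in2 :: 'w::ab_group_add \<Rightarrow> 'v::ab_group_add \<times> 'w)"
  by unfold_locales (auto simp: in2_def inj_def)

text \<open>
  The signs are forced, up to a global one, by compatibility with the differentials of
  \<open>tot (opp A) (op_cpx \<xi>)\<close> and \<open>dual A (tot A \<xi>)\<close>. The inverse reads off the three components on the
  identities of \<open>X\<close>, \<open>Y\<close>, \<open>Z\<close>, which sit in degrees \<open>-2\<close>, \<open>-1\<close>, \<open>0\<close> of \<open>\<Sigma>\<^sup>2X \<oplus> \<Sigma>Y \<oplus> Z\<close>.
\<close>

fun to_dual where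
  "to_dual A (Cx X Y Z f g h) V p ((x', y'), z') =
     ext0 A (tot A (Cx X Y Z f g h)) (\<lambda>U q ((x, y), z).
       cmp A U X V p (q + 2) z' x + sg p (cmp A U Y V (p + 1) (q + 1) y' y)
         - cmp A U Z V (p + 2) q x' z)"

fun from_dual where
  "from_dual A (Cx X Y Z f g h) V p \<phi> =
     ((- \<phi> Z 0 ((0, 0), idn A Z), sg p (\<phi> Y (- 1) ((0, idn A Y), 0))), \<phi> X (- 2) ((idn A X, 0), 0))"

lemma to_dual_mem:
  assumes "dg_category A" "\<xi> \<in> cpx_obj A" "V \<in> obj A" "u \<in> mcar (tot (opp A) (op_cpx \<xi>)) V p"
  shows "to_dual A \<xi> V p u \<in> mhom A (tot A \<xi>) (rep A V) (p + 2)"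
proof -
  interpret dg_category A by fact
  obtain X Y Z f g h where \<xi>: "\<xi> = Cx X Y Z f g h" by (cases \<xi>)
  obtain x' y' z' where u: "u = ((x', y'), z')" by (cases u) auto
  note * = assms(2-4)[unfolded \<xi> u Cx_mem, simplified]
  show ?thesis
    unfolding \<xi> u to_dual.simps
    by (rule ext0_mhom, goal_cases)
      (use * assms(1) in \<open>cases "even p"; auto simp: assoc algebra_simps sg_def\<close>)+
qed

lemma iso_pair_dual:
  assumes "dg_category A" "\<xi> \<in> cpx_obj A"
  shows "iso_pair (opp A) (tot (opp A) (op_cpx \<xi>)) (shift 2 (dual A (tot A \<xi>)))
    (ext0 (opp A) (tot (opp A) (op_cpx \<xi>)) (to_dual A \<xi>))
    (ext0 (opp A) (shift 2 (dual A (tot A \<xi>))) (from_dual A \<xi>))"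
proof -
  interpret dg_category A by fact
  obtain X Y Z f g h where \<xi>: "\<xi> = Cx X Y Z f g h" by (cases \<xi>)
  note * = assms(2)[unfolded \<xi> Cx_mem]
  have t: "dg_module A (tot A \<xi>)" using assms by simp
  have d: "dg_module (opp A) (dual A (tot A \<xi>))" using dg_module_dual t by blast
  show ?thesis
  proof (rule iso_pairI, goal_cases)
    case 1
    show ?case using assms by (intro dg_module_tot dg_category_opp op_cpx_mem)
  next
    case 2
    show ?case using d by (rule dg_module.dg_module_shift)
  next
    case (3 V p u)
    then show ?case using to_dual_mem[OF assms] by simp
  next
    case (4 V p u v)
    then show ?case using *
      by (auto simp: \<xi> fun_eq_iff ext0_apply sg_def)
  next
    case (5 V p u c)
    then show ?case using *
      by (auto simp: \<xi> fun_eq_iff ext0_apply sg_def mhom_scl_def algebra_simps)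
  next
    case (6 V W p q u a)
    then show ?case using *
      by (cases "even p"; cases "even q"; auto simp: \<xi> fun_eq_iff ext0_apply sg_def mcomp_def assoc algebra_simps)
  next
    case (7 V p u)
    \<comment> \<open>Compatibility with the differentials. Those of \<Sigma>Y and of the coordinate
      \<open>y'\<close> both carry a minus, which the alternating sign on \<open>y'y\<close>
      reconciles. The entry \<open>f\<close> then forces \<open>z'x\<close> to have coefficient 1,
      and \<open>g\<close> forces the minus on \<open>x'z\<close>; the entry \<open>h\<close> is
      consistent with both.\<close>
    then show ?case using *
      by (cases "even p"; auto simp: \<xi> fun_eq_iff ext0_apply sg_def mhom_dif_def assoc dif_cmp' algebra_simps)
  next
    case (8 V p \<phi>)
    then interpret P: dg_functional A "tot A \<xi>" V "p + 2" \<phi> by (simp add: dg_functional_iff t)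
    show ?case using 8 * by (auto simp: \<xi> P.mem_rep[unfolded \<xi>])
  next
    case (9 V p \<phi>)
    then interpret P: dg_functional A "tot A \<xi>" V "p + 2" \<phi> by (simp add: dg_functional_iff t)
    have V: "V \<in> obj A" using 9 by simp
    \<comment> \<open>Yoneda on each summand: \<open>x\<close>, \<open>y\<close>, \<open>z\<close>
      are the identities of \<open>X\<close>, \<open>Y\<close>, \<open>Z\<close> acted on by
      \<open>x\<close>, \<open>y\<close>, \<open>z\<close>, and \<phi> commutes with the action.
      Hence \<phi> is determined by the three values that \<open>from_dual\<close> reads
      off.\<close>
    have expand: "\<phi> U q ((x, y), z) = cmp A U X V p (q + 2) (\<phi> X (- 2) ((idn A X, 0), 0)) x
       + cmp A U Y V (p + 1) (q + 1) (\<phi> Y (- 1) ((0, idn A Y), 0)) y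
         + cmp A U Z V (p + 2) q (\<phi> Z 0 ((0, 0), idn A Z)) z"
      if "U \<in> obj A" "x \<in> hom A U X (q + 2)" "y \<in> hom A U Y (q + 1)" "z \<in> hom A U Z q" for U q x y z
    proof -
      have "\<phi> U q ((x, y), z) = \<phi> U q (((x, 0), 0) + ((0, y), 0) + ((0, 0), z))" by simp
      also have "\<dots> = \<phi> U q ((x, 0), 0) + \<phi> U q ((0, y), 0) + \<phi> U q ((0, 0), z)"
        using that * by (subst P.add | simp add: \<xi>)+
      also have "\<phi> U q ((x, 0), 0) = cmp A U X V p (q + 2) (\<phi> X (- 2) ((idn A X, 0), 0)) x"
        using P.act[of U X "((idn A X, 0), 0)" "- 2" x "q + 2" q] that * by (simp add: \<xi>)
      also have "\<phi> U q ((0, y), 0) = cmp A U Y V (p + 1) (q + 1) (\<phi> Y (- 1) ((0, idn A Y), 0)) y"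
        using P.act[of U Y "((0, idn A Y), 0)" "- 1" y "q + 1" q] that * by (simp add: \<xi> add.commute)
      also have "\<phi> U q ((0, 0), z) = cmp A U Z V (p + 2) q (\<phi> Z 0 ((0, 0), idn A Z)) z"
        using P.act[of U Z "((0, 0), idn A Z)" 0 z q q] that * by (simp add: \<xi> add.commute)
      finally show ?thesis .
    qed
    have "to_dual A \<xi> V p (from_dual A \<xi> V p \<phi>) = ext0 A (tot A \<xi>) \<phi>"
      unfolding \<xi> to_dual.simps from_dual.simps
    proof (rule ext0_eqI, goal_cases)
      case (1 U q v)
      obtain x y z where v: "v = ((x, y), z)" by (cases v) auto
      have U: "U \<in> obj A" "x \<in> hom A U X (q + 2)" "y \<in> hom A U Y (q + 1)" "z \<in> hom A U Z q"
        using 1 by (auto simp: v)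
      show ?case
        unfolding v prod.case expand[OF U]
        using * V U by (simp add: sg_def P.mem_rep[unfolded \<xi>])
    qed
    then show ?case by simp
  next
    case (10 V p u)
    then show ?case using * by (auto simp: \<xi> sg_def)
  qed
qed

text \<open>Seen as a pairing of triples, \<open>to_dual\<close> makes the matrices of a morphism
  and of its opposite adjoint to each other, up to \<open>(-1)^(n p)\<close>. Each side is a sum of
  six threefold composites, one for each component of \<Xi>, and they agree term by term.\<close>

lemma to_dual_natural:
  assumes "dg_category A" "\<xi> \<in> cpx_obj A" "\<xi>' \<in> cpx_obj A" "\<Xi> \<in> cpx_hom A \<xi> \<xi>' n"
  defines "S \<equiv> \<lambda>\<xi>. tot (opp A) (op_cpx \<xi>)"
  shows "mcomp (opp A) (S \<xi>') 0 (fmor (Shift 2) (dual A (tot A \<xi>')) (dual A (tot A \<xi>)) n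
       (fmor (Dual A) (tot A \<xi>') (tot A \<xi>) n (tot_mor A \<xi> \<xi>' n \<Xi>))) (ext0 (opp A) (S \<xi>') (to_dual A \<xi>'))
    = mcomp (opp A) (S \<xi>') n (ext0 (opp A) (S \<xi>) (to_dual A \<xi>))
       (tot_mor (opp A) (op_cpx \<xi>') (op_cpx \<xi>) n (fmor Op3 \<xi>' \<xi> n \<Xi>))"
proof -
  interpret dg_category A by fact
  obtain X Y Z f g h where \<xi>: "\<xi> = Cx X Y Z f g h" by (cases \<xi>)
  obtain X' Y' Z' f' g' h' where \<xi>': "\<xi>' = Cx X' Y' Z' f' g' h'" by (cases \<xi>')
  obtain r0 r1 r2 s1 s2 t where \<Xi>: "\<Xi> = (r0, r1, r2, s1, s2, t)" by (cases \<Xi>)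
  note * = assms(2-4)[unfolded \<xi> \<xi>' \<Xi> Cx_mem, simplified]
  show ?thesis
    unfolding mcomp_def[of "opp A"]
  proof (rule ext0_eqI, goal_cases)
    case (1 V p u)
    obtain x' y' z' where u: "u = ((x', y'), z')" by (cases u) auto
    have m: "to_dual A \<xi>' V p u \<in> mhom A (tot A \<xi>') (rep A V) (p + 2)"
      using 1 to_dual_mem[of A \<xi>' V u p] assms by (simp add: S_def)
    have V: "V \<in> obj A" "x' \<in> hom A Z' V (p + 2)" "y' \<in> hom A Y' V (p + 1)" "z' \<in> hom A X' V p"
      using 1 by (auto simp: S_def \<xi>' u)
    \<comment> \<open>The even shift changes no sign: \<open>(-1)^(2 n)\<close> is 1 and the dual
      degree \<open>p + 2\<close> has the parity of \<open>p\<close>.\<close>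
    have "fmor (Shift 2) (dual A (tot A \<xi>')) (dual A (tot A \<xi>)) n
       (fmor (Dual A) (tot A \<xi>') (tot A \<xi>) n
         (tot_mor A \<xi> \<xi>' n \<Xi>)) V (p + 0) (ext0 (opp A) (S \<xi>') (to_dual A \<xi>') V p u)
      = sg (n * p) (mcomp A (tot A \<xi>) n (to_dual A \<xi>' V p u) (tot_mor A \<xi> \<xi>' n \<Xi>))"
      using 1 m by (simp add: sg_def)
    also have "\<dots> = to_dual A \<xi> V (p + n)
      (tot_mor (opp A) (op_cpx \<xi>') (op_cpx \<xi>) n (fmor Op3 \<xi>' \<xi> n \<Xi>) V p u)"
    proof (rule mhom_eqI[of _ A "tot A \<xi>" "rep A V" "p + n + 2"], goal_cases)
      case 1
      show ?case
        by (rule dual_mor_mem[OF _ _ tot_mor_mhom V(1) m]) (use assms in simp_all)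
    next
      case 2
      have "tot_mor (opp A) (op_cpx \<xi>') (op_cpx \<xi>) n (fmor Op3 \<xi>' \<xi> n \<Xi>) V p u
        \<in> mcar (tot (opp A) (op_cpx \<xi>)) V (p + n)"
        using * V by (simp add: \<xi> \<xi>' \<Xi> u sg_def)
      then show ?case by (rule to_dual_mem[OF assms(1,2) V(1)])
    next
      case (3 U q v)
      obtain x y z where v: "v = ((x, y), z)" by (cases v) auto
      have U: "U \<in> obj A" "x \<in> hom A U X (q + 2)" "y \<in> hom A U Y (q + 1)" "z \<in> hom A U Z q"
        using 3 by (auto simp: \<xi> v)
      \<comment> \<open>Composition in the opposite category becomes precomposition in
        \<open>A\<close>, with exponent the degree of the component of \<Xi> times that of the
        coordinate of \<open>u\<close>. This combines with the matrix signs and with the minus signs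
        of the opposite morphism.\<close>
      have w: "tot_mor (opp A) (op_cpx \<xi>') (op_cpx \<xi>) n (fmor Op3 \<xi>' \<xi> n \<Xi>) V p u
        = ((sg (n * p) (cmp A Z Z' V (p + 2) n x' r2),
            sg (n + (n - 1) * p) (cmp A Y Z' V (p + 2) (n - 1) x' s2) + sg (n * p)
              (cmp A Y Y' V (p + 1) n y' r1)),
           sg (n * p) (cmp A X Z' V (p + 2) (n - 2) x' t) + sg ((n - 1) * (p + 1))
             (cmp A X Y' V (p + 1) (n - 1) y' s1)
             + sg (n * p) (cmp A X X' V p n z' r0))"
        using * V by (simp add: \<xi> \<xi>' \<Xi> u sg_def)
      have tm: "tot_mor A \<xi> \<xi>' n \<Xi> U q v
        = ((cmp A U X X' n (q + 2) r0 x,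
            - sg n (cmp A U X Y' (n - 1) (q + 2) s1 x) + sg n (cmp A U Y Y' n (q + 1) r1 y)),
           - cmp A U X Z' (n - 2) (q + 2) t x - cmp A U Y Z' (n - 1) (q + 1) s2 y
             + cmp A U Z Z' n q r2 z)"
        using * U by (simp add: \<xi> \<xi>' \<Xi> v sg_def)
      have "mcomp A (tot A \<xi>) n (to_dual A \<xi>' V p u) (tot_mor A \<xi> \<xi>' n \<Xi>) U q v
        = to_dual A \<xi>' V p u U (q + n) (tot_mor A \<xi> \<xi>' n \<Xi> U q v)"
        using 3 by (simp add: mcomp_def)
      note L = this
      note [simp] = * V U
      \<comment> \<open>\<open>L2\<close> and \<open>L3\<close> distribute the left pairing;
        \<open>R1\<close> to \<open>R3\<close> distribute and reassociate the right one, so that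
        both sides consist of the same right-nested composites.\<close>
      have L2: "cmp A U Y' V (p + 1) (q + n + 1) y'
          (- sg n (cmp A U X Y' (n - 1) (q + 2) s1 x) + sg n (cmp A U Y Y' n (q + 1) r1 y))
        = - sg n (cmp A U Y' V (p + 1) (q + n + 1) y' (cmp A U X Y' (n - 1) (q + 2) s1 x))
          + sg n (cmp A U Y' V (p + 1) (q + n + 1) y' (cmp A U Y Y' n (q + 1) r1 y))"
        by (cases "even n"; simp add: sg_def)
      have L3: "cmp A U Z' V (p + 2) (q + n) x'
          (- cmp A U X Z' (n - 2) (q + 2) t x - cmp A U Y Z' (n - 1) (q + 1) s2 y
            + cmp A U Z Z' n q r2 z)
        = - cmp A U Z' V (p + 2) (q + n) x' (cmp A U X Z' (n - 2) (q + 2) t x)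
          - cmp A U Z' V (p + 2) (q + n) x' (cmp A U Y Z' (n - 1) (q + 1) s2 y)
          + cmp A U Z' V (p + 2) (q + n) x' (cmp A U Z Z' n q r2 z)"
        by simp
      \<comment> \<open>\<open>cmp\<close> is indexed by degrees, so the two sides agree only after normalizing these\<close>
      have ix: "n - 2 + (q + 2) = q + n" "n - 1 + (q + 2) = q + n + 1" "n + (q + 2) = q + n + 2"
        "n - 1 + (q + 1) = q + n" "n + (q + 1) = q + n + 1" "n + q = q + n"
        by simp_all
      have R1: "cmp A U X V (p + n) (q + 2) (sg (n * p) (cmp A X Z' V (p + 2) (n - 2) x' t)
          + sg ((n - 1) * (p + 1)) (cmp A X Y' V (p + 1) (n - 1) y' s1) + sg (n * p)
            (cmp A X X' V p n z' r0)) x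
        = sg (n * p) (cmp A U Z' V (p + 2) (q + n) x' (cmp A U X Z' (n - 2) (q + 2) t x))
          + sg ((n - 1) * (p + 1)) (cmp A U Y' V (p + 1) (q + n + 1) y'
            (cmp A U X Y' (n - 1) (q + 2) s1 x))
          + sg (n * p) (cmp A U X' V p (q + n + 2) z' (cmp A U X X' n (q + 2) r0 x))"
        by (cases "even n"; cases "even p"; simp add: sg_def assoc ix)
      have R2: "cmp A U Y V (p + n + 1) (q + 1) (sg (n + (n - 1) * p)
        (cmp A Y Z' V (p + 2) (n - 1) x' s2)
          + sg (n * p) (cmp A Y Y' V (p + 1) n y' r1)) y
        = sg (n + (n - 1) * p) (cmp A U Z' V (p + 2) (q + n) x' (cmp A U Y Z' (n - 1) (q + 1) s2 y))
          + sg (n * p) (cmp A U Y' V (p + 1) (q + n + 1) y' (cmp A U Y Y' n (q + 1) r1 y))"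
        by (cases "even n"; cases "even p"; simp add: sg_def assoc ix)
      have R3: "cmp A U Z V (p + n + 2) q (sg (n * p) (cmp A Z Z' V (p + 2) n x' r2)) z
        = sg (n * p) (cmp A U Z' V (p + 2) (q + n) x' (cmp A U Z Z' n q r2 z))"
        by (cases "even n"; cases "even p"; simp add: sg_def assoc ix)
      have "sg (n * p) (to_dual A \<xi>' V p u U (q + n) (tot_mor A \<xi> \<xi>' n \<Xi> U q v))
        = to_dual A \<xi> V (p + n) (tot_mor (opp A) (op_cpx \<xi>') (op_cpx \<xi>) n (fmor Op3 \<xi>' \<xi> n \<Xi>) V p u) U q v"
        unfolding w tm unfolding \<xi> \<xi>' u v
        by (cases "even n"; cases "even p"; simp add: L2 L3 R1 R2 R3; simp add: sg_def)
      then show ?case by (simp only: sg_apply L)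
    qed
    also have "\<dots> = ext0 (opp A) (S \<xi>) (to_dual A \<xi>) V (p + n)
      (tot_mor (opp A) (op_cpx \<xi>') (op_cpx \<xi>) n (fmor Op3 \<xi>' \<xi> n \<Xi>) V p u)"
      using * V by (subst ext0_in) (auto simp: \<xi> \<xi>' \<Xi> u S_def sg_def)
    finally show ?case .
  qed
qed

theorem lemma1p29:
  fixes A :: "('k::comm_ring_1, 'o, 'm::ab_group_add) dgcat"
  assumes "dg_category A" and "additive_dg A"
  shows "(\<exists>\<eta>. dg_nat_iso (opp (Cpx3 A)) (pretr (opp A))
            (Copy in1 \<circ>\<^sub>F Tot (opp A) \<circ>\<^sub>F Op3)
            (Copy in2 \<circ>\<^sub>F (Shift 2 \<circ>\<^sub>F Dual A) \<circ>\<^sub>F opp_fun (Tot A)) \<eta>)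
       \<and> (\<forall>\<xi>\<in>obj (Cpx3 A). mod_iso (opp A) (tot (opp A) (op_cpx \<xi>)) (shift 2 (dual A (tot A \<xi>))))"
proof
  \<comment> \<open>The annotations make both functors land in modules over the same product
    type.\<close>
  let ?F = "Copy (in1 :: _ \<Rightarrow> _ \<times> ('o \<Rightarrow> int \<Rightarrow> ('m \<times> 'm) \<times> 'm \<Rightarrow> 'm)) \<circ>\<^sub>F Tot (opp A) \<circ>\<^sub>F Op3"
  let ?G = "Copy (in2 :: _ \<Rightarrow> (('m \<times> 'm) \<times> 'm) \<times> _) \<circ>\<^sub>F (Shift 2 \<circ>\<^sub>F Dual A) \<circ>\<^sub>F opp_fun (Tot A)"
  let ?S = "\<lambda>\<xi>. tot (opp A) (op_cpx \<xi>)" and ?T = "\<lambda>\<xi>. shift 2 (dual A (tot A \<xi>))"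
  let ?\<eta> = "\<lambda>\<xi>. ext0 (opp A) (?S \<xi>) (to_dual A \<xi>)" and ?\<theta> = "\<lambda>\<xi>. ext0 (opp A) (?T \<xi>) (from_dual A \<xi>)"
  have O: "dg_category (opp A)" using assms(1) by (rule dg_category_opp)
  have S: "?S \<xi> \<in> obj (pretr (opp A))" if "\<xi> \<in> cpx_obj A" for \<xi>
    using that O by (intro tot_pretr) auto
  have iso: "mod_iso (opp A) (?S \<xi>) (?T \<xi>)" if "\<xi> \<in> cpx_obj A" for \<xi>
    using iso_pair_dual[OF assms(1) that] unfolding mod_iso_iff by blast
  then show "\<forall>\<xi>\<in>obj (Cpx3 A). mod_iso (opp A) (?S \<xi>) (?T \<xi>)" by simp
  have dT: "dg_module (opp A) (?T \<xi>)" if "\<xi> \<in> cpx_obj A" for \<xi>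
    using assms(1) that by (intro dg_module.dg_module_shift dg_module_dual dg_module_tot)
  have dS: "dg_module (opp A) (?S \<xi>)" if "\<xi> \<in> cpx_obj A" for \<xi>
    using S[OF that] obj_pretr by blast
  have T: "?T \<xi> \<in> obj (pretr (opp A))" if "\<xi> \<in> cpx_obj A" for \<xi>
    using pretr_mod_iso S iso dT that by blast
  \<comment> \<open>Functoriality is composed inside all dg modules and restricted to the hull
    afterwards, where the membership facts \<open>S\<close> and \<open>T\<close> suffice.\<close>
  have "dg_functor (opp (Cpx3 A)) (Cdg (opp A)) ?F"
    by (rule dg_functor_fcomp[OF dg_functor_fcomp[OF dg_functor_Op3[OF assms(1)] dg_functor_Tot[OF O]]
          dg_functor_Copy[OF embedding_in1]])
  then have F: "dg_functor (opp (Cpx3 A)) (pretr (opp A)) ?F"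
    by (rule dg_functor_pretr) (simp add: pretr_copy embedding_in1 S)
  have "dg_functor (opp (Cpx3 A)) (Cdg (opp A)) ?G"
    by (rule dg_functor_fcomp[OF dg_functor_fcomp[OF dg_functor_opp_Tot[OF assms(1)]
          dg_functor_fcomp[OF dg_functor_Dual[OF assms(1)] dg_functor_Shift]] dg_functor_Copy[OF embedding_in2]])
  then have G: "dg_functor (opp (Cpx3 A)) (pretr (opp A)) ?G"
    by (rule dg_functor_pretr) (simp add: pretr_copy embedding_in2 T)
  have "dg_nat_iso (opp (Cpx3 A)) (pretr (opp A)) ?F ?G (\<lambda>\<xi>. copy_mor in1 in2 (?\<eta> \<xi>))"
    unfolding dg_nat_iso_def
  proof (intro conjI F G ballI allI)
    fix \<xi> assume \<xi>: "\<xi> \<in> obj (opp (Cpx3 A))"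
    have *: "iso_pair (opp A) (fob ?F \<xi>) (fob ?G \<xi>) (copy_mor in1 in2 (?\<eta> \<xi>)) (copy_mor in2 in1 (?\<theta> \<xi>))"
      using iso_pair_copy[OF embedding_in1 embedding_in2 dS dT iso_pair_dual[OF assms(1)]] \<xi> by simp
    then show "copy_mor in1 in2 (?\<eta> \<xi>) \<in> closed0 (pretr (opp A)) (fob ?F \<xi>) (fob ?G \<xi>)"
      unfolding closed0_def iso_pair_def by simp
    show "\<exists>\<theta>\<in>closed0 (pretr (opp A)) (fob ?G \<xi>) (fob ?F \<xi>).
        cmp (pretr (opp A)) (fob ?F \<xi>) (fob ?G \<xi>) (fob ?F \<xi>) 0 0 \<theta> (copy_mor in1 in2 (?\<eta> \<xi>))
          = idn (pretr (opp A)) (fob ?F \<xi>) \<and>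
        cmp (pretr (opp A)) (fob ?G \<xi>) (fob ?F \<xi>) (fob ?G \<xi>) 0 0 (copy_mor in1 in2 (?\<eta> \<xi>)) \<theta>
          = idn (pretr (opp A)) (fob ?G \<xi>)"
      using * unfolding closed0_def iso_pair_def
        by (intro bexI[of _ "copy_mor in2 in1 (?\<theta> \<xi>)"]) simp_all
  next
    fix \<xi>' \<xi> n \<Xi>
    assume "\<xi>' \<in> obj (opp (Cpx3 A))" "\<xi> \<in> obj (opp (Cpx3 A))" "\<Xi> \<in> hom (opp (Cpx3 A)) \<xi>' \<xi> n"
    then show "cmp (pretr (opp A)) (fob ?F \<xi>') (fob ?G \<xi>') (fob ?G \<xi>) n 0 (fmor ?G \<xi>' \<xi> n \<Xi>) (copy_mor in1 in2 (?\<eta> \<xi>'))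
      = cmp (pretr (opp A)) (fob ?F \<xi>') (fob ?F \<xi>) (fob ?G \<xi>) 0 n (copy_mor in1 in2 (?\<eta> \<xi>)) (fmor ?F \<xi>' \<xi> n \<Xi>)"
      \<comment> \<open>A morphism from \<xi>' to \<xi> in the opposite category is a sextuple from
        \<xi> to \<xi>'. Copying commutes with composition, which reduces the square to the uncopied
        one; \<open>Shift\<close> and \<open>Dual\<close> stay folded to match it.\<close>
      using to_dual_natural[OF assms(1), of \<xi> \<xi>' \<Xi> n]
      by (simp add: copy_mor_mcomp embedding_in1 embedding_in2 del: Shift_sel(2) Dual_sel(2))
  qed
  then show "\<exists>\<eta>. dg_nat_iso (opp (Cpx3 A)) (pretr (opp A)) ?F ?G \<eta>" by blast
qed

end
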